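(* Let $D=\{\zeta\in\mathbb{C}:|\zeta|<1\}$, let $\Omega=D\times D\subset\mathbb{C}^2$ be the unit bidisc, let $a,b\in\mathbb{C}$ with $0<|a|<1$, $0<|b|<1$ and $a\neq b$, and let $A=\{((a,0),1),((b,0),2)\}$ (pole $(a,0)$ with weight $1$, pole $(b,0)$ with weight $2$). Then $\delta_\Omega(\cdot,A)\not\equiv g_\Omega(\cdot,A)$ on $\Omega$; that is, there exists $z\in\Omega$ with $\delta_\Omega(z,A)\neq g_\Omega(z,A)$.
   Context: Let $\Omega\subset\mathbb{C}^n$ be a domain and $A=\{(w_1,\nu_1),\ldots,(w_k,\nu_k)\}\subset\Omega\times[0,\infty)$ with distinct poles $w_j$ and weights $\nu_j$. Pluricomplex Green function: $g_\Omega(z,A)=\sup\{u(z)\}$, the supremum being over all plurisubharmonic functions $u\le 0$ on $\Omega$ such that for each $j$ there is a constant $C_u$ with $u(\zeta)-\nu_j\log|\zeta-w_j|\le C_u$ for $\zeta$ near $w_j$. Lempert function: for $z\in\Omega$, let $F_z$ be the family of holomorphic maps $f:D\to\Omega$ with $f(0)=z$ for which there exist $\zeta_1,\ldots,\zeta_k\in D$ with $f(\zeta_j)=w_j$ for $j=1,\ldots,k$; put $d(f)=\sum_{j=1}^k\nu_j\log|\zeta_j|$. Then $\delta_\Omega(z,A)=\inf d(f)$, the infimum being over all $f\in F_z$ (and all admissible choices of the $\zeta_j$), with $\log 0=-\infty$. *)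

theory Defs
  imports "HOL-Analysis.Analysis"
begin

text \<open>
  Functions with values in $[-\infty, \infty)$ are modelled as total functions into \<^typ>\<open>ereal\<close>;
  their values outside the set under consideration are irrelevant.
\<close>

definition usc_on :: "'a::topological_space set \<Rightarrow> ('a \<Rightarrow> ereal) \<Rightarrow> bool" where
  "usc_on U u \<longleftrightarrow> (\<forall>c. openin (top_of_set U) {z \<in> U. u z < c})"

text \<open>
  The mean of \<open>u\<close> over the circle of radius \<open>r\<close> around \<open>z\<close>, as an extended Lebesgue
  integral (positive part minus negative part; \<open>e2ennreal\<close> truncates negative values to 0).
  If \<open>u\<close> is upper semicontinuous and less than \<open>\<infinity>\<close> on the circle, then the first
  integral is finite, so the difference is meaningful; it may be \<open>-\<infinity>\<close>.
\<close>

definition circle_mean :: "(complex \<Rightarrow> ereal) \<Rightarrow> complex \<Rightarrow> real \<Rightarrow> ereal" where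
  "circle_mean u z r =
     (enn2ereal (\<integral>\<^sup>+ \<theta>\<in>{0..2*pi}. e2ennreal (u (z + of_real r * cis \<theta>)) \<partial>lborel)
      - enn2ereal (\<integral>\<^sup>+ \<theta>\<in>{0..2*pi}. e2ennreal (- u (z + of_real r * cis \<theta>)) \<partial>lborel))
     / ereal (2 * pi)"

text \<open>
  The function that is constantly \<open>-\<infinity>\<close> is admitted as (pluri)subharmonic; this has no
  influence on the supremum defining the Green function.
\<close>

definition subharmonic_on :: "complex set \<Rightarrow> (complex \<Rightarrow> ereal) \<Rightarrow> bool" where
  "subharmonic_on U u \<longleftrightarrow>
     usc_on U u \<and> (\<forall>z\<in>U. u z < \<infinity>) \<and>
     (\<forall>z r. 0 < r \<and> cball z r \<subseteq> U \<longrightarrow> u z \<le> circle_mean u z r)"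

definition plurisubharmonic_on :: "(complex ^ 'n) set \<Rightarrow> (complex ^ 'n \<Rightarrow> ereal) \<Rightarrow> bool" where
  "plurisubharmonic_on \<Omega> u \<longleftrightarrow>
     usc_on \<Omega> u \<and> (\<forall>z\<in>\<Omega>. u z < \<infinity>) \<and>
     (\<forall>z v. subharmonic_on {\<zeta>. z + \<zeta> *s v \<in> \<Omega>} (\<lambda>\<zeta>. u (z + \<zeta> *s v)))"

text \<open>
  A system of weighted poles is a finite set of pairs (pole, weight) in which no pole
  occurs with two different weights. The singularity condition is stated on punctured
  neighbourhoods, where \<open>ln (norm (\<zeta> - w))\<close> is the genuine logarithm.
\<close>

definition pluricomplex_green ::
  "(complex ^ 'n) set \<Rightarrow> ((complex ^ 'n) \<times> real) set \<Rightarrow> complex ^ 'n \<Rightarrow> ereal" where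
  "pluricomplex_green \<Omega> A z =
     Sup {u z | u. plurisubharmonic_on \<Omega> u \<and> (\<forall>\<zeta>\<in>\<Omega>. u \<zeta> \<le> 0) \<and>
       (\<forall>(w, \<nu>)\<in>A. \<exists>C::real. \<forall>\<^sub>F \<zeta> in at w. u \<zeta> - ereal (\<nu> * ln (norm (\<zeta> - w))) \<le> ereal C)}"

definition log_ereal :: "real \<Rightarrow> ereal" where
  "log_ereal x = (if x = 0 then -\<infinity> else ereal (ln x))"

text \<open>
  Since the poles are distinct, the parameters $\zeta_1, \ldots, \zeta_k$ can be indexed by the
  poles themselves: \<open>\<zeta> w\<close> is the parameter belonging to the pole \<open>w\<close>.
\<close>

definition lempert_function ::
  "(complex ^ 'n) set \<Rightarrow> ((complex ^ 'n) \<times> real) set \<Rightarrow> complex ^ 'n \<Rightarrow> ereal" where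
  "lempert_function \<Omega> A z =
     Inf {\<Sum>(w, \<nu>)\<in>A. ereal \<nu> * log_ereal (norm (\<zeta> w)) | f \<zeta>.
       (\<forall>i. (\<lambda>\<xi>. f \<xi> $ i) holomorphic_on ball 0 1) \<and> f ` ball 0 1 \<subseteq> \<Omega> \<and> f 0 = z \<and>
       (\<forall>(w, \<nu>)\<in>A. \<zeta> w \<in> ball 0 1 \<and> f (\<zeta> w) = w)}"

definition bidisc :: "(complex ^ 2) set" where
  "bidisc = {z. norm (z $ 1) < 1 \<and> norm (z $ 2) < 1}"

end

theory Submission
  imports Defs "HOL-Complex_Analysis.Complex_Analysis"
begin

text \<open>
  The functions are separated at a point \<open>z = (0, y)\<close> with
  \<open>norm a * norm b < norm y < norm b\<close>; the number to compare with is
  \<open>h = ln (norm y) + ln (norm b)\<close>.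

  The Green function is at most \<open>h\<close>. Let \<open>u\<close> be a competitor. On the circle \<open>norm y = norm b\<close> of
  the line \<open>z\<^sub>1 = 0\<close> it is at most \<open>2 * ln (norm b)\<close>, as one sees on graphs of unimodular multiples
  of the Moebius function with zero \<open>b\<close>; on the circle \<open>norm y = norm a * norm b\<close> it is at most
  \<open>ln (norm a) + 2 * ln (norm b)\<close>, as one sees on graphs of multiples of the product of the Moebius
  functions with zeros \<open>a\<close> and \<open>b\<close> (\<open>psh_bound_double_pole\<close>, \<open>psh_bound_both_poles\<close>). On the
  annulus in between, \<open>h\<close> is harmonic in \<open>y\<close> with exactly these boundary values, so \<open>u \<le> h\<close> by the
  maximum principle (\<open>psh_bound_annulus\<close>).

  The Lempert function exceeds \<open>h\<close>. A disc through \<open>z\<close> and the two poles, with parameters \<open>s\<close> and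
  \<open>t\<close>, satisfies \<open>norm y \<le> norm s * norm t\<close> and \<open>norm b \<le> norm t\<close> by the Schwarz lemma, whence
  \<open>h \<le> ln (norm s) + 2 * ln (norm t)\<close>. Near equality makes the first coordinate nearly a rotation,
  so \<open>norm s\<close> is nearly \<open>norm a\<close>, while near equality in the first inequality makes it nearly
  \<open>norm y / norm b > norm a\<close>. The lemmas \<open>three_point_Schwarz_Pick\<close> and \<open>parameter_gap\<close> turn this
  contradiction into a gap independent of the disc.

  The graphs above are not complex lines, whereas plurisubharmonicity is defined by restriction to
  lines. The bridge is a maximum principle along arbitrary holomorphic discs,
  \<open>psh_maximum_principle_along_disc\<close>, obtained by maximising \<open>u (f \<zeta> + y)\<close> over the parameter \<open>\<zeta>\<close>
  and a penalised displacement \<open>y\<close> simultaneously (\<open>doubled_function_no_local_max\<close>).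
\<close>

section \<open>Subharmonic functions and harmonic majorants\<close>

lemma mean_value_holomorphic:
  assumes "G holomorphic_on cball z r" "0 < r"
  shows "((\<lambda>\<theta>. G (z + of_real r * cis \<theta>)) has_integral (of_real (2 * pi) * G z)) {0..2*pi}"
proof -
  have "((\<lambda>u. G u / (u - z)) has_contour_integral (2 * of_real pi * \<i> * G z)) (part_circlepath z r 0 (2*pi))"
    using Cauchy_integral_circlepath_simple[OF assms(1), of z] assms(2)
    by (simp add: circlepath_def)
  then have "((\<lambda>t. G (z + r * cis t) / (r * cis t) * r * \<i> * cis t) has_integral (2 * of_real pi * \<i> * G z)) {0..2*pi}"
    by (subst (asm) has_contour_integral_part_circlepath_iff) auto
  then have "((\<lambda>t. G (z + r * cis t) * \<i>) has_integral (2 * of_real pi * \<i> * G z)) {0..2*pi}"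
    by (rule has_integral_eq[rotated]) (use assms(2) in \<open>simp add: field_simps\<close>)
  from has_integral_mult_left[OF this, of "-\<i>"]
  show ?thesis
    by (simp add: algebra_simps)
qed

text \<open>
  Only monotonicity of the extended integral is used on the side of \<open>u\<close>, so no measurability
  of \<open>u\<close> enters; the positive and negative parts of the continuous majorant are finite.
\<close>

lemma circle_mean_le_harmonic:
  assumes G: "G holomorphic_on cball z r" and r: "0 < r"
    and le: "\<And>\<zeta>. norm (\<zeta> - z) = r \<Longrightarrow> u \<zeta> \<le> ereal (Re (G \<zeta>))"
  shows "circle_mean u z r \<le> ereal (Re (G z))"
proof -
  define k where "k \<theta> = Re (G (z + of_real r * cis \<theta>))" for \<theta> :: real
  have on: "norm (z + of_real r * cis \<theta> - z) = r" for \<theta>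
    using r by (simp add: norm_mult)
  have uk: "u (z + of_real r * cis \<theta>) \<le> ereal (k \<theta>)" for \<theta>
    unfolding k_def by (rule le[OF on])
  have "((\<lambda>\<theta>. Re (G (z + of_real r * cis \<theta>))) has_integral Re (of_real (2 * pi) * G z)) {0..2*pi}"
    using has_integral_linear[OF mean_value_holomorphic[OF G r] bounded_linear_Re] by (simp add: o_def)
  then have kI: "(k has_integral 2 * pi * Re (G z)) {0..2*pi}"
    by (simp add: k_def [abs_def])
  have "continuous_on {0..2*pi} (\<lambda>\<theta>. G (z + of_real r * cis \<theta>))"
    by (rule continuous_on_compose2[OF holomorphic_on_imp_continuous_on[OF G]])
       (use on r in \<open>auto intro!: continuous_intros simp: dist_norm norm_mult\<close>)
  then have ck: "continuous_on {0..2*pi} k"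
    unfolding k_def by (intro continuous_intros)
  define P N where "P = integral {0..2*pi} (\<lambda>\<theta>. max 0 (k \<theta>))"
    and "N = integral {0..2*pi} (\<lambda>\<theta>. max 0 (- k \<theta>))"
  have PI: "((\<lambda>\<theta>. max 0 (k \<theta>)) has_integral P) {0..2*pi}"
    unfolding P_def by (intro integrable_integral integrable_continuous_real continuous_intros ck)
  have NI: "((\<lambda>\<theta>. max 0 (- k \<theta>)) has_integral N) {0..2*pi}"
    unfolding N_def by (intro integrable_integral integrable_continuous_real continuous_intros ck)
  have P0: "P \<ge> 0" "N \<ge> 0"
    using has_integral_nonneg[OF PI] has_integral_nonneg[OF NI] by auto
  have "((\<lambda>\<theta>. max 0 (k \<theta>) - max 0 (- k \<theta>)) has_integral (P - N)) {0..2*pi}"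
    by (intro has_integral_diff PI NI)
  moreover have "(\<lambda>\<theta>. max 0 (k \<theta>) - max 0 (- k \<theta>)) = k"
    by (auto simp: max_def)
  ultimately have PN: "P - N = 2 * pi * Re (G z)"
    using kI has_integral_unique by metis
  have "(\<integral>\<^sup>+ \<theta>\<in>{0..2*pi}. e2ennreal (u (z + of_real r * cis \<theta>)) \<partial>lborel)
      \<le> (\<integral>\<^sup>+ \<theta>\<in>{0..2*pi}. ennreal (max 0 (k \<theta>)) \<partial>lborel)"
  proof (intro nn_integral_mono mult_right_mono)
    fix \<theta> :: real
    show "e2ennreal (u (z + of_real r * cis \<theta>)) \<le> ennreal (max 0 (k \<theta>))"
      by (rule order_trans[OF e2ennreal_mono[OF uk[of \<theta>]]]) (auto intro: ennreal_leI)
  qed auto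
  also have "\<dots> = ennreal P"
    using nn_integral_has_integral_lebesgue'[OF _ PI] by simp
  finally have 1: "enn2ereal (\<integral>\<^sup>+ \<theta>\<in>{0..2*pi}. e2ennreal (u (z + of_real r * cis \<theta>)) \<partial>lborel) \<le> ereal P"
    using P0 by (metis enn2ereal_ennreal less_eq_ennreal.rep_eq)
  have "ennreal N = (\<integral>\<^sup>+ \<theta>\<in>{0..2*pi}. ennreal (max 0 (- k \<theta>)) \<partial>lborel)"
    using nn_integral_has_integral_lebesgue'[OF _ NI] by simp
  also have "\<dots> \<le> (\<integral>\<^sup>+ \<theta>\<in>{0..2*pi}. e2ennreal (- u (z + of_real r * cis \<theta>)) \<partial>lborel)"
  proof (intro nn_integral_mono mult_right_mono)
    fix \<theta> :: real
    have "ereal (- k \<theta>) \<le> - u (z + of_real r * cis \<theta>)"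
      using uk[of \<theta>] by (metis ereal_minus_le_minus uminus_ereal.simps(1))
    from e2ennreal_mono[OF this]
    moreover have "ennreal (max 0 (- k \<theta>)) = ennreal (- k \<theta>)"
      by (simp add: max_def ennreal_neg)
    ultimately show "ennreal (max 0 (- k \<theta>)) \<le> e2ennreal (- u (z + of_real r * cis \<theta>))"
      by simp
  qed auto
  finally have 2: "ereal N \<le> enn2ereal (\<integral>\<^sup>+ \<theta>\<in>{0..2*pi}. e2ennreal (- u (z + of_real r * cis \<theta>)) \<partial>lborel)"
    using P0 by (metis enn2ereal_ennreal less_eq_ennreal.rep_eq)
  have "circle_mean u z r \<le> (ereal P - ereal N) / ereal (2 * pi)"
    unfolding circle_mean_def
    by (intro ereal_divide_right_mono ereal_minus_mono 1 2) auto
  also have "\<dots> = ereal (Re (G z))"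
    using PN by simp
  finally show ?thesis .
qed

text \<open>
  This is the only form in which the sub-mean value property is used below: a harmonic majorant on
  the circle is a majorant at the centre.
\<close>

lemma subharmonic_on_le_harmonic:
  assumes "subharmonic_on U u" "cball z r \<subseteq> U" "0 < r" "G holomorphic_on cball z r"
    and "\<And>\<zeta>. norm (\<zeta> - z) = r \<Longrightarrow> u \<zeta> \<le> ereal (Re (G \<zeta>))"
  shows "u z \<le> ereal (Re (G z))"
  using circle_mean_le_harmonic[of G z r u] assms
  unfolding subharmonic_on_def by (meson order_trans)

text \<open>
  If the supremum were not attained, the sets \<open>{y. F y < F x}\<close> would be an open cover without a
  finite subcover.
\<close>

lemma compact_attains_max_of_usc:
  fixes F :: "'a::topological_space \<Rightarrow> real"
  assumes "compact X" "X \<noteq> {}"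
    and usc: "\<And>x t. x \<in> X \<Longrightarrow> F x < t \<Longrightarrow> \<forall>\<^sub>F y in at x within X. F y < t"
  obtains m where "m \<in> X" "\<And>x. x \<in> X \<Longrightarrow> F x \<le> F m"
proof (rule ccontr)
  assume "\<not> thesis"
  with that have "\<forall>x\<in>X. \<exists>y\<in>X. F x < F y"
    by (metis not_le)
  then obtain b where b: "\<And>x. x \<in> X \<Longrightarrow> b x \<in> X \<and> F x < F (b x)"
    by metis
  have "\<exists>T. open T \<and> x \<in> T \<and> (\<forall>y\<in>T \<inter> X. F y < F (b x))" if "x \<in> X" for x
  proof -
    have "\<forall>\<^sub>F y in at x within X. F y < F (b x)"
      using usc[OF that] b[OF that] by blast
    then obtain S where S: "open S" "x \<in> S" "\<And>y. y \<in> S \<Longrightarrow> y \<noteq> x \<Longrightarrow> y \<in> X \<Longrightarrow> F y < F (b x)"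
      unfolding eventually_at_topological by metis
    have "\<forall>y\<in>S \<inter> X. F y < F (b x)"
      using S(3) b[OF that] by (metis IntD1 IntD2)
    with S(1,2) show ?thesis by metis
  qed
  then obtain T where T: "\<And>x. x \<in> X \<Longrightarrow> open (T x) \<and> x \<in> T x \<and> (\<forall>y\<in>T x \<inter> X. F y < F (b x))"
    by metis
  obtain C where C: "C \<subseteq> X" "finite C" "X \<subseteq> (\<Union>c\<in>C. T c)"
    by (rule compactE_image[OF assms(1), of X T]) (use T in auto)
  have "C \<noteq> {}"
    using C assms(2) by auto
  then have "Max ((F \<circ> b) ` C) \<in> (F \<circ> b) ` C"
    using C(2) by (intro Max_in) auto
  then obtain c where c: "c \<in> C" "F (b c) = Max ((F \<circ> b) ` C)"
    by auto
  have cmax: "F (b d) \<le> F (b c)" if "d \<in> C" for d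
    unfolding c(2) using C(2) that by (intro Max_ge) auto
  have "b c \<in> X"
    using b c C by auto
  then obtain d where "d \<in> C" "b c \<in> T d"
    using C by auto
  then have "F (b c) < F (b d)"
    using T[of d] C(1) \<open>b c \<in> X\<close> by blast
  then show False
    using cmax[OF \<open>d \<in> C\<close>] by simp
qed

section \<open>The maximum principle along holomorphic discs\<close>

text \<open>
  Harmonic majorants on circles in complex lines, real parts of holomorphic functions, replace the
  integral means. This property survives truncation from below, which makes a plurisubharmonic
  function real-valued.
\<close>

definition real_psh :: "(complex ^ 'n) set \<Rightarrow> (complex ^ 'n \<Rightarrow> real) \<Rightarrow> bool" where
  "real_psh \<Omega> v \<longleftrightarrow>
     (\<forall>x\<in>\<Omega>. \<forall>t. v x < t \<longrightarrow> (\<forall>\<^sub>F y in nhds x. v y < t)) \<and>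
     (\<forall>x w r G. 0 < r \<longrightarrow> (\<forall>\<zeta>\<in>cball 0 r. x + \<zeta> *s w \<in> \<Omega>) \<longrightarrow> G holomorphic_on cball 0 r \<longrightarrow>
        (\<forall>\<zeta>. norm \<zeta> = r \<longrightarrow> v (x + \<zeta> *s w) \<le> Re (G \<zeta>)) \<longrightarrow> v x \<le> Re (G 0))"

lemma norm_diff_power2:
  fixes x y :: "'a::real_inner"
  shows "(norm (x - y))\<^sup>2 = (norm x)\<^sup>2 - 2 * inner x y + (norm y)\<^sup>2"
  by (simp add: power2_norm_eq_inner inner_diff_left inner_diff_right inner_commute)

lemma vec_linear_approximation:
  fixes f :: "complex \<Rightarrow> complex ^ 'n"
  assumes hol: "\<And>i. (\<lambda>\<xi>. f \<xi> $ i) holomorphic_on S" and "open S" "q \<in> S" "0 < s"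
  defines "w \<equiv> \<chi> i. deriv (\<lambda>\<xi>. f \<xi> $ i) q"
  obtains d where "0 < d" "\<And>\<zeta>. norm \<zeta> < d \<Longrightarrow> norm (f (q + \<zeta>) - f q - \<zeta> *s w) \<le> s * norm \<zeta>"
proof -
  let ?c = "s / CARD('n)"
  have c: "?c > 0"
    using assms by simp
  have "\<exists>d>0. \<forall>\<zeta>. norm \<zeta> < d \<longrightarrow> norm ((f (q + \<zeta>) - f q - \<zeta> *s w) $ i) \<le> ?c * norm \<zeta>" for i
  proof -
    have "((\<lambda>\<xi>. f \<xi> $ i) has_field_derivative w $ i) (at q)"
      unfolding w_def using holomorphic_derivI[OF hol \<open>open S\<close> \<open>q \<in> S\<close>] by simp
    then obtain d where "d > 0"
      "\<And>y. norm (y - q) < d \<Longrightarrow> norm (f y $ i - f q $ i - w $ i * (y - q)) \<le> ?c * norm (y - q)"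
      unfolding has_field_derivative_def has_derivative_at_alt using c by metis
    from this(1) this(2)[of "q + _"] show ?thesis
      by (intro exI[of _ d]) (simp add: mult.commute)
  qed
  then obtain d where d: "\<And>i. d i > 0"
    "\<And>i \<zeta>. norm \<zeta> < d i \<Longrightarrow> norm ((f (q + \<zeta>) - f q - \<zeta> *s w) $ i) \<le> ?c * norm \<zeta>"
    by metis
  show ?thesis
  proof (rule that[of "Min (range d)"])
    show "0 < Min (range d)"
      using d(1) by simp
    fix \<zeta> :: complex assume *: "norm \<zeta> < Min (range d)"
    have "norm (f (q + \<zeta>) - f q - \<zeta> *s w) \<le> (\<Sum>i\<in>UNIV. norm ((f (q + \<zeta>) - f q - \<zeta> *s w) $ i))"
      unfolding norm_vec_def by (rule L2_set_le_sum) simp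
    also have "\<dots> \<le> (\<Sum>i\<in>(UNIV::'n set). ?c * norm \<zeta>)"
      by (intro sum_mono d(2)) (use * in simp)
    also have "\<dots> = s * norm \<zeta>"
      by simp
    finally show "norm (f (q + \<zeta>) - f q - \<zeta> *s w) \<le> s * norm \<zeta>" .
  qed
qed

text \<open>
  The sub-mean value property of \<open>v\<close> is available on complex lines only, so the curve \<open>f\<close> is
  replaced by its tangent line at \<open>q\<close> and the displacement \<open>y\<close> absorbs the difference: at the
  parameter \<open>q + \<zeta>\<close> the displacement \<open>y0 - E \<zeta>\<close>, with \<open>E\<close> the error of linearisation, puts
  \<open>f (q + \<zeta>) + y\<close> exactly on the line through \<open>f q + y0\<close>. The penalty changes by
  \<open>2 * k * inner y0 (E \<zeta>)\<close>, the real part of a holomorphic function vanishing at the centre, and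
  by \<open>k * (norm (E \<zeta>))\<^sup>2\<close>, which is of smaller order than \<open>r\<^sup>2\<close>. The mean of the term
  \<open>\<delta> * (norm \<zeta>)\<^sup>2\<close> exceeds its central value by \<open>\<delta> * r\<^sup>2\<close>, and this wins.
\<close>

lemma doubled_function_no_local_max:
  fixes f :: "complex \<Rightarrow> complex ^ 'n"
  assumes v: "real_psh \<Omega> v" and "open \<Omega>"
    and hol: "\<And>i. (\<lambda>\<xi>. f \<xi> $ i) holomorphic_on ball q e"
    and L: "L holomorphic_on ball q e"
    and pos: "0 < e" "0 < \<rho>" "0 < k" "0 < \<delta>"
    and in\<Omega>: "f q + y0 \<in> \<Omega>"
    and max: "\<And>\<zeta> y. \<zeta> \<in> ball q e \<Longrightarrow> y \<in> ball y0 \<rho> \<Longrightarrow>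
        v (f \<zeta> + y) - k * (norm y)\<^sup>2 - Re (L \<zeta>) + \<delta> * (norm \<zeta>)\<^sup>2
        \<le> v (f q + y0) - k * (norm y0)\<^sup>2 - Re (L q) + \<delta> * (norm q)\<^sup>2"
  shows False
proof -
  \<comment> \<open>The accuracy of linearisation at which the penalty costs only half of the gain.\<close>
  define s where "s = sqrt (\<delta> / (2 * k))"
  have s: "s > 0" "k * s\<^sup>2 = \<delta> / 2"
    using pos by (auto simp: s_def field_simps)
  define w where "w = (\<chi> i. deriv (\<lambda>\<xi>. f \<xi> $ i) q)"
  obtain d where d: "0 < d" "\<And>\<zeta>. norm \<zeta> < d \<Longrightarrow> norm (f (q + \<zeta>) - f q - \<zeta> *s w) \<le> s * norm \<zeta>"
    using vec_linear_approximation[OF hol open_ball _ s(1), of q] pos(1) unfolding w_def by auto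
  obtain d2 where d2: "d2 > 0" "ball (f q + y0) d2 \<subseteq> \<Omega>"
    using \<open>open \<Omega>\<close> in\<Omega> open_contains_ball by blast
  define r where "r = Min {e, d, \<rho> / s, d2 / (norm w + 1)} / 2"
  have nw: "norm w + 1 > 0"
    using norm_ge_zero[of w] by linarith
  have "Min {e, d, \<rho> / s, d2 / (norm w + 1)} > 0"
    using pos d s d2 nw by (simp add: add_nonneg_pos)
  then have r0: "r > 0" and "2 * r \<le> e" "2 * r \<le> d" "2 * r \<le> \<rho> / s" "2 * r \<le> d2 / (norm w + 1)"
    unfolding r_def by auto
  then have r: "r < e" "r < d" "s * r < \<rho>" "r * (norm w + 1) < d2"
    using s nw pos d2 by (auto simp: field_simps)
  define E where "E \<zeta> = f (q + \<zeta>) - f q - \<zeta> *s w" for \<zeta>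
  define eh where "eh \<zeta> = (\<Sum>i\<in>UNIV. cnj (y0 $ i) * (f (q + \<zeta>) $ i - f q $ i - \<zeta> * w $ i))" for \<zeta>
  have Re_eh: "Re (eh \<zeta>) = inner y0 (E \<zeta>)" for \<zeta>
    unfolding eh_def E_def inner_vec_def by (simp add: inner_complex_def)
  have holt: "(\<lambda>\<zeta>. h (q + \<zeta>)) holomorphic_on cball 0 r" if "h holomorphic_on ball q e" for h
  proof -
    have "h \<circ> (\<lambda>\<zeta>. q + \<zeta>) holomorphic_on cball 0 r"
      by (rule holomorphic_on_compose_gen[OF _ that])
         (use r in \<open>auto intro!: holomorphic_intros simp: dist_norm\<close>)
    then show ?thesis
      by (simp add: o_def)
  qed
  define \<Phi> where "\<Phi> = v (f q + y0) - k * (norm y0)\<^sup>2 - Re (L q) + \<delta> * (norm q)\<^sup>2"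
  \<comment> \<open>The harmonic majorant of \<open>v\<close> on the circle of radius \<open>r\<close> in the tangent line that the maximality gives.\<close>
  define G where "G \<zeta> = of_real (\<Phi> + k * (norm y0)\<^sup>2 + k * (s * r)\<^sup>2 - \<delta> * ((norm q)\<^sup>2 + r\<^sup>2))
       - of_real (2 * k) * eh \<zeta> + L (q + \<zeta>) - of_real (2 * \<delta>) * (cnj q * \<zeta>)" for \<zeta>
  have "eh holomorphic_on cball 0 r"
    unfolding eh_def by (intro holomorphic_intros holt hol)
  then have G: "G holomorphic_on cball 0 r"
    unfolding G_def by (intro holomorphic_intros holt L)
  have "v (f q + y0 + \<zeta> *s w) \<le> Re (G \<zeta>)" if \<zeta>: "norm \<zeta> = r" for \<zeta>
  proof -
    have En: "norm (E \<zeta>) \<le> s * r"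
      unfolding E_def using d(2)[of \<zeta>] r \<zeta> by simp
    have "v (f (q + \<zeta>) + (y0 - E \<zeta>)) - k * (norm (y0 - E \<zeta>))\<^sup>2 - Re (L (q + \<zeta>)) + \<delta> * (norm (q + \<zeta>))\<^sup>2 \<le> \<Phi>"
      unfolding \<Phi>_def by (rule max) (use \<zeta> r En in \<open>auto simp: dist_norm\<close>)
    moreover have "f (q + \<zeta>) + (y0 - E \<zeta>) = f q + y0 + \<zeta> *s w"
      by (simp add: E_def)
    moreover have "(norm (y0 - E \<zeta>))\<^sup>2 \<le> (norm y0)\<^sup>2 - 2 * Re (eh \<zeta>) + (s * r)\<^sup>2"
      unfolding norm_diff_power2 Re_eh using power_mono[OF En, of 2] by simp
    then have "k * (norm (y0 - E \<zeta>))\<^sup>2 \<le> k * ((norm y0)\<^sup>2 - 2 * Re (eh \<zeta>) + (s * r)\<^sup>2)"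
      using pos by (intro mult_left_mono) auto
    moreover have "(norm (q + \<zeta>))\<^sup>2 = (norm q)\<^sup>2 + r\<^sup>2 + 2 * Re (cnj q * \<zeta>)"
      unfolding \<zeta>[symmetric] cmod_power2 by (simp add: power2_eq_square algebra_simps)
    ultimately show ?thesis
      by (simp add: G_def algebra_simps)
  qed
  moreover have "f q + y0 + \<zeta> *s w \<in> \<Omega>" if "\<zeta> \<in> cball 0 r" for \<zeta>
  proof -
    have "norm (\<zeta> *s w) = norm \<zeta> * norm w"
      by (simp add: norm_vec_def L2_set_right_distrib norm_mult)
    also have "\<dots> \<le> r * (norm w + 1)"
      using that r0 by (intro mult_mono) auto
    finally show ?thesis
      using d2(2) r(4) by (auto simp: dist_norm subset_iff)
  qed
  ultimately have "v (f q + y0) \<le> Re (G 0)"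
    using v G r0 unfolding real_psh_def by blast
  moreover have "eh 0 = 0"
    by (simp add: eh_def)
  ultimately have "0 \<le> k * (s * r)\<^sup>2 - \<delta> * r\<^sup>2"
    by (simp add: G_def \<Phi>_def algebra_simps)
  also have "k * (s * r)\<^sup>2 = \<delta> / 2 * r\<^sup>2"
    unfolding s(2)[symmetric] by (simp add: power_mult_distrib)
  also have "\<delta> / 2 * r\<^sup>2 - \<delta> * r\<^sup>2 = - (\<delta> / 2) * r\<^sup>2"
    by simp
  finally show False
    using pos r0 by (simp add: mult_le_0_iff)
qed

lemma eventually_less_add:
  fixes a c :: "'a \<Rightarrow> real"
  assumes "\<And>t. a0 < t \<Longrightarrow> \<forall>\<^sub>F y in F. a y < t" and "(c \<longlongrightarrow> c0) F" and "a0 + c0 < t"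
  shows "\<forall>\<^sub>F y in F. a y + c y < t"
proof -
  define e where "e = (t - a0 - c0) / 2"
  have "e > 0"
    using assms(3) by (simp add: e_def)
  then have "\<forall>\<^sub>F y in F. a y < a0 + e" "\<forall>\<^sub>F y in F. c y < c0 + e"
    using assms(1)[of "a0 + e"] order_tendstoD(2)[OF assms(2), of "c0 + e"] by auto
  then show ?thesis
    by eventually_elim (simp add: e_def field_simps)
qed

lemma real_psh_uscD:
  assumes "real_psh \<Omega> v" "x \<in> \<Omega>" "v x < t"
  shows "\<forall>\<^sub>F y in nhds x. v y < t"
  using assms unfolding real_psh_def by blast

text \<open>
  If the estimate failed, then for a large penalty \<open>k\<close> the function
  \<open>v (f \<zeta> + y) - k * (norm y)\<^sup>2 - H \<zeta> + \<delta> * (norm \<zeta>)\<^sup>2\<close> would take its maximum over small \<open>y\<close>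
  and \<open>\<zeta> \<in> K\<close> at a pair with \<open>y\<close> inside its ball (the penalty is prohibitive at the rim) and \<open>\<zeta>\<close>
  inside \<open>K\<close> (by semicontinuity the boundary estimate persists, up to a small error, under small
  displacements). Such an interior maximum is impossible. The doubling of variables takes the place
  of smoothing \<open>v\<close> and of the chain rule for the Levi form.
\<close>

proposition real_psh_maximum_principle:
  fixes f :: "complex \<Rightarrow> complex ^ 'n"
  assumes v: "real_psh \<Omega> v" and op: "open \<Omega>" "open S"
    and bd: "\<And>x. x \<in> \<Omega> \<Longrightarrow> v x \<le> 0"
    and K: "compact K" "K \<subseteq> S"
    and hol: "\<And>i. (\<lambda>\<xi>. f \<xi> $ i) holomorphic_on S" and f: "f ` S \<subseteq> \<Omega>"
    and H: "continuous_on K H"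
    and harm: "\<And>q. q \<in> interior K \<Longrightarrow>
        \<exists>e>0. \<exists>L. L holomorphic_on ball q e \<and> (\<forall>\<zeta>\<in>ball q e. H \<zeta> = Re (L \<zeta>))"
    and fr: "\<And>\<zeta>. \<zeta> \<in> frontier K \<Longrightarrow> v (f \<zeta>) \<le> H \<zeta>"
    and p: "p \<in> K"
  shows "v (f p) \<le> H p"
proof (rule ccontr)
  assume "\<not> v (f p) \<le> H p"
  define \<eta> where "\<eta> = v (f p) - H p"
  have \<eta>: "\<eta> > 0"
    using \<open>\<not> v (f p) \<le> H p\<close> by (simp add: \<eta>_def)
  have cf: "continuous_on S f"
    using continuous_on_vec_lambda[of S "\<lambda>i x. f x $ i"] hol holomorphic_on_imp_continuous_on
    by (simp add: vec_nth_inverse)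
  obtain R where R: "R > 0" "\<And>\<zeta>. \<zeta> \<in> K \<Longrightarrow> norm \<zeta> \<le> R"
    using compact_imp_bounded[OF K(1)] bounded_pos by blast
  obtain h where h: "\<And>\<zeta>. \<zeta> \<in> K \<Longrightarrow> \<bar>H \<zeta>\<bar> \<le> h"
    using compact_imp_bounded[OF compact_continuous_image[OF H K(1)]]
    unfolding bounded_iff by auto
  define \<delta> where "\<delta> = \<eta> / (4 * R\<^sup>2)"
  have \<delta>: "\<delta> > 0" 
    using \<eta> R by (simp add: \<delta>_def)
  have \<delta>R: "\<delta> * (norm \<zeta>)\<^sup>2 \<le> \<eta> / 4" if "\<zeta> \<in> K" for \<zeta>
  proof -
    have "\<delta> * (norm \<zeta>)\<^sup>2 \<le> \<delta> * R\<^sup>2"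
      using \<delta> R(2)[OF that] by (intro mult_left_mono power_mono) auto
    then show ?thesis
      using R by (simp add: \<delta>_def)
  qed
  obtain \<rho>1 where \<rho>1: "\<rho>1 > 0" "\<And>\<zeta> y. \<zeta> \<in> K \<Longrightarrow> norm y \<le> \<rho>1 \<Longrightarrow> f \<zeta> + y \<in> \<Omega>"
  proof -
    have "compact (f ` K)" "f ` K \<subseteq> \<Omega>"
      using compact_continuous_image[OF continuous_on_subset[OF cf K(2)] K(1)] f K(2) by auto
    from compact_subset_open_imp_cball_epsilon_subset[OF this(1) op(1) this(2)]
    obtain e where "e > 0" "(\<Union>x\<in>f ` K. cball x e) \<subseteq> \<Omega>"
      by blast
    then show ?thesis
    proof (intro that[of e])
      fix \<zeta> y assume "\<zeta> \<in> K" "norm (y :: complex ^ 'n) \<le> e"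
      then have "f \<zeta> + y \<in> (\<Union>x\<in>f ` K. cball x e)"
        by (intro UN_I[of "f \<zeta>"]) (auto simp: dist_norm)
      with \<open>(\<Union>x\<in>f ` K. cball x e) \<subseteq> \<Omega>\<close> show "f \<zeta> + y \<in> \<Omega>"
        by blast
    qed
  qed
  have tf: "((\<lambda>z. f (fst z) + snd z) \<longlongrightarrow> f \<zeta> + y) (at (\<zeta>, y) within K \<times> Y)" if "\<zeta> \<in> K" for \<zeta> y Y
  proof -
    have "continuous_on (K \<times> UNIV) (\<lambda>z. f (fst z) + snd z)"
      by (intro continuous_intros continuous_on_compose2[OF continuous_on_subset[OF cf K(2)]]) auto
    then have "((\<lambda>z. f (fst z) + snd z) \<longlongrightarrow> f \<zeta> + y) (at (\<zeta>, y) within K \<times> UNIV)"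
      unfolding continuous_on_def using that by force
    then show ?thesis
      by (rule tendsto_within_subset) auto
  qed
  have tH: "((\<lambda>z. H (fst z)) \<longlongrightarrow> H \<zeta>) (at (\<zeta>, y) within K \<times> Y)" if "\<zeta> \<in> K" for \<zeta> and y :: "complex ^ 'n" and Y
  proof -
    have "continuous_on (K \<times> UNIV) (\<lambda>z. H (fst z))"
      by (intro continuous_on_compose2[OF H] continuous_intros) auto
    then have "((\<lambda>z. H (fst z)) \<longlongrightarrow> H \<zeta>) (at (\<zeta>, y) within K \<times> UNIV)"
      unfolding continuous_on_def using that by force
    then show ?thesis
      by (rule tendsto_within_subset) auto
  qed
  have usc: "\<forall>\<^sub>F z in at (\<zeta>, y) within K \<times> Y. v (f (fst z) + snd z) < t"
    if "\<zeta> \<in> K" "norm y \<le> \<rho>1" "v (f \<zeta> + y) < t" for \<zeta> y t Y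
    using filterlim_iff[THEN iffD1, OF tf[OF that(1), of y Y], rule_format, OF
      real_psh_uscD[OF v \<rho>1(2)[OF that(1,2)] that(3)]] .
  \<comment> \<open>Semicontinuity spreads the boundary estimate over all displacements of size at most some \<open>\<rho>\<close>.\<close>
  obtain \<rho> where \<rho>: "0 < \<rho>" "\<rho> \<le> \<rho>1"
    "\<And>\<zeta> y. \<zeta> \<in> frontier K \<Longrightarrow> norm y \<le> \<rho> \<Longrightarrow> v (f \<zeta> + y) < H \<zeta> + \<eta> / 2"
  proof -
    have frK: "frontier K \<subseteq> K"
      using K(1) compact_imp_closed frontier_subset_closed by blast
    have "\<exists>T. open T \<and> (\<zeta>, 0) \<in> T \<and>
      (\<forall>z\<in>T \<inter> (K \<times> UNIV). v (f (fst z) + snd z) < H (fst z) + \<eta> / 2)" if "\<zeta> \<in> frontier K" for \<zeta>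
    proof -
      have "\<zeta> \<in> K" using that frK by auto
      have "\<forall>\<^sub>F z in at (\<zeta>, 0) within K \<times> UNIV. v (f (fst z) + snd z) + - H (fst z) < \<eta> / 2"
      proof (rule eventually_less_add[where ?a0.0 = "v (f \<zeta> + 0)" and ?c0.0 = "- H \<zeta>"])
        show "((\<lambda>z. - H (fst z)) \<longlongrightarrow> - H \<zeta>) (at (\<zeta>, 0 :: complex ^ 'n) within K \<times> UNIV)"
          by (intro tendsto_minus tH \<open>\<zeta> \<in> K\<close>)
        show "v (f \<zeta> + 0) + - H \<zeta> < \<eta> / 2"
          using fr[OF that] \<eta> by simp
      qed (use usc[OF \<open>\<zeta> \<in> K\<close>, of 0] \<rho>1 in simp)
      then obtain T where T: "open T" "(\<zeta>, 0) \<in> T"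
        "\<And>z. z \<in> T \<Longrightarrow> z \<noteq> (\<zeta>, 0) \<Longrightarrow> z \<in> K \<times> UNIV \<Longrightarrow> v (f (fst z) + snd z) + - H (fst z) < \<eta> / 2"
        unfolding eventually_at_topological by metis
      moreover have "v (f \<zeta> + 0) + - H \<zeta> < \<eta> / 2"
        using fr[OF that] \<eta> by simp
      ultimately have "v (f (fst z) + snd z) < H (fst z) + \<eta> / 2" if "z \<in> T \<inter> (K \<times> UNIV)" for z
      proof (cases "z = (\<zeta>, 0)")
        case True
        then show ?thesis
          using \<open>v (f \<zeta> + 0) + - H \<zeta> < \<eta> / 2\<close> by simp
      next
        case False
        then show ?thesis
          using T(3)[of z] that by force
      qed
      with T(1,2) show ?thesis
        by blast
    qed
    then obtain T where T: "\<And>\<zeta>. \<zeta> \<in> frontier K \<Longrightarrow> open (T \<zeta>) \<and> (\<zeta>, 0) \<in> T \<zeta> \<and>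
      (\<forall>z\<in>T \<zeta> \<inter> (K \<times> UNIV). v (f (fst z) + snd z) < H (fst z) + \<eta> / 2)"
      by metis
    have "compact ((\<lambda>\<zeta>. (\<zeta>, 0 :: complex ^ 'n)) ` frontier K)"
      by (intro compact_continuous_image continuous_intros compact_frontier K)
    moreover have "open (\<Union>\<zeta>\<in>frontier K. T \<zeta>)"
      using T by auto
    moreover have "(\<lambda>\<zeta>. (\<zeta>, 0)) ` frontier K \<subseteq> (\<Union>\<zeta>\<in>frontier K. T \<zeta>)"
      using T by auto
    ultimately obtain e where e: "e > 0"
      "(\<Union>x\<in>(\<lambda>\<zeta>. (\<zeta>, 0)) ` frontier K. cball x e) \<subseteq> (\<Union>\<zeta>\<in>frontier K. T \<zeta>)"
      using compact_subset_open_imp_cball_epsilon_subset by metis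
    show ?thesis
    proof (rule that[of "min e \<rho>1"])
      fix \<zeta> :: complex and y :: "complex ^ 'n" assume *: "\<zeta> \<in> frontier K" "norm y \<le> min e \<rho>1"
      then have "(\<zeta>, y) \<in> cball (\<zeta>, 0) e"
        by (simp add: dist_Pair_Pair)
      with e(2) *(1) obtain \<zeta>' where "\<zeta>' \<in> frontier K" "(\<zeta>, y) \<in> T \<zeta>'"
        by blast
      with T[of \<zeta>'] * frK show "v (f \<zeta> + y) < H \<zeta> + \<eta> / 2"
        by force
    qed (use e \<rho>1 in auto)
  qed
  \<comment> \<open>At a displacement of size \<open>\<rho>\<close> this penalty outweighs all other terms.\<close>
  define k where "k = (h + \<eta> / 4 + 1) / \<rho>\<^sup>2"
  have "h \<ge> 0"
    using h[OF p] by linarith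
  then have k: "k > 0" "k * \<rho>\<^sup>2 = h + \<eta> / 4 + 1"
    using \<eta> \<rho>(1) by (auto simp: k_def)
  define \<Phi> where "\<Phi> z = v (f (fst z) + snd z) + (- k * (norm (snd z))\<^sup>2 - H (fst z) + \<delta> * (norm (fst z))\<^sup>2)"
    for z
  obtain z0 where z0: "z0 \<in> K \<times> cball 0 \<rho>" "\<And>z. z \<in> K \<times> cball 0 \<rho> \<Longrightarrow> \<Phi> z \<le> \<Phi> z0"
  proof (rule compact_attains_max_of_usc[of "K \<times> cball 0 \<rho>" \<Phi>])
    show "compact (K \<times> cball (0 :: complex ^ 'n) \<rho>)"
      by (intro compact_Times K compact_cball)
    show "K \<times> cball (0 :: complex ^ 'n) \<rho> \<noteq> {}"
      using p \<rho>(1) by auto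
    fix x :: "complex \<times> (complex ^ 'n)" and t assume x: "x \<in> K \<times> cball 0 \<rho>" "\<Phi> x < t"
    obtain \<zeta> y where xy: "x = (\<zeta>, y)"
      by (cases x)
    have \<zeta>y: "\<zeta> \<in> K" "norm y \<le> \<rho>1"
      using x(1) xy \<rho>(2) by auto
    show "\<forall>\<^sub>F z in at x within K \<times> cball 0 \<rho>. \<Phi> z < t"
      unfolding \<Phi>_def
    proof (rule eventually_less_add)
      show "\<forall>\<^sub>F z in at x within K \<times> cball 0 \<rho>. v (f (fst z) + snd z) < t'" if "v (f \<zeta> + y) < t'" for t'
        unfolding xy using usc[OF \<zeta>y that] .
      show "((\<lambda>z. - k * (norm (snd z))\<^sup>2 - H (fst z) + \<delta> * (norm (fst z))\<^sup>2) \<longlongrightarrow>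
          - k * (norm y)\<^sup>2 - H \<zeta> + \<delta> * (norm \<zeta>)\<^sup>2) (at x within K \<times> cball 0 \<rho>)"
        unfolding xy by (rule tendsto_eq_intros tH \<zeta>y refl | simp)+
      show "v (f \<zeta> + y) + (- k * (norm y)\<^sup>2 - H \<zeta> + \<delta> * (norm \<zeta>)\<^sup>2) < t"
        using x(2) by (simp add: \<Phi>_def xy)
    qed
  qed (rule that)
  obtain q y0 where qy: "z0 = (q, y0)"
    by (cases z0)
  have q: "q \<in> K" "norm y0 \<le> \<rho>" 
    using z0(1) qy by auto
  then have in\<Omega>: "f q + y0 \<in> \<Omega>"
    using \<rho>1 \<rho> by auto
  have "\<Phi> (p, 0) \<ge> \<eta>"
    using \<delta> by (simp add: \<Phi>_def \<eta>_def)
  then have \<Phi>\<eta>: "\<Phi> (q, y0) \<ge> \<eta>"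
    using z0(2)[of "(p, 0)"] p \<rho>(1) qy by simp
  have y0: "norm y0 < \<rho>"
  proof (rule ccontr)
    assume "\<not> norm y0 < \<rho>"
    then have "norm y0 = \<rho>" using q by simp
    then have "\<Phi> (q, y0) \<le> - (h + \<eta> / 4 + 1) + h + \<eta> / 4"
      using bd[OF in\<Omega>] k(2) h[OF q(1)] \<delta>R[OF q(1)] by (simp add: \<Phi>_def)
    then show False
      using \<Phi>\<eta> \<eta> by simp
  qed
  have "q \<notin> frontier K"
  proof
    assume "q \<in> frontier K"
    from \<rho>(3)[OF this q(2)] \<delta>R[OF q(1)] have "\<Phi> (q, y0) < \<eta> / 2 + \<eta> / 4 - k * (norm y0)\<^sup>2"
      by (simp add: \<Phi>_def)
    also have "\<dots> \<le> \<eta> / 2 + \<eta> / 4"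
      using k by simp
    finally show False
      using \<Phi>\<eta> \<eta> by simp
  qed
  then have qi: "q \<in> interior K"
    using q(1) closure_subset unfolding frontier_def by auto
  obtain e L where eL: "e > 0" "L holomorphic_on ball q e" "\<And>\<zeta>. \<zeta> \<in> ball q e \<Longrightarrow> H \<zeta> = Re (L \<zeta>)"
    using harm[OF qi] by blast
  obtain e' where e': "e' > 0" "ball q e' \<subseteq> K"
    using qi mem_interior by blast
  define e0 where "e0 = min e e'"
  have e0: "e0 > 0" "ball q e0 \<subseteq> K" "ball q e0 \<subseteq> ball q e"
    using eL e' by (auto simp: e0_def)
  show False
  proof (rule doubled_function_no_local_max[OF v op(1), where f = f and q = q and e = e0 and L = L
        and \<rho> = "\<rho> - norm y0" and k = k and \<delta> = \<delta> and ?y0.0 = y0])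
    show "(\<lambda>\<xi>. f \<xi> $ i) holomorphic_on ball q e0" for i
      by (rule holomorphic_on_subset[OF hol]) (use e0 K in auto)
    show "L holomorphic_on ball q e0"
      by (rule holomorphic_on_subset[OF eL(2) e0(3)])
    fix \<zeta> y assume *: "\<zeta> \<in> ball q e0" "y \<in> ball y0 (\<rho> - norm y0)"
    have "norm y \<le> \<rho>"
      using *(2) norm_triangle_ineq2[of y y0] by (simp add: dist_norm norm_minus_commute)
    then have "\<Phi> (\<zeta>, y) \<le> \<Phi> (q, y0)"
      using z0(2)[of "(\<zeta>, y)"] * e0 qy by auto
    moreover have "H \<zeta> = Re (L \<zeta>)" "H q = Re (L q)"
      using eL * e0 by auto
    ultimately show "v (f \<zeta> + y) - k * (norm y)\<^sup>2 - Re (L \<zeta>) + \<delta> * (norm \<zeta>)\<^sup>2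
        \<le> v (f q + y0) - k * (norm y0)\<^sup>2 - Re (L q) + \<delta> * (norm q)\<^sup>2"
      by (simp add: \<Phi>_def)
  qed (use e0 y0 k \<delta> in\<Omega> in auto)
qed

text \<open>
  The level \<open>- N\<close> lies below \<open>Re (G 0)\<close> whenever it lies below \<open>Re \<circ> G\<close> on the circle, by the mean
  value property of \<open>G\<close>; therefore harmonic majorants of the truncation behave like those of \<open>u\<close>.
\<close>

lemma real_psh_truncation:
  fixes N :: real
  assumes u: "plurisubharmonic_on \<Omega> u" and "open \<Omega>"
  defines "v \<equiv> \<lambda>z. real_of_ereal (max (u z) (ereal (- N)))"
  shows "real_psh \<Omega> v" "\<And>x. x \<in> \<Omega> \<Longrightarrow> ereal (v x) = max (u x) (ereal (- N))"
proof -
  show v: "ereal (v x) = max (u x) (ereal (- N))" if "x \<in> \<Omega>" for x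
  proof -
    have "u x < \<infinity>"
      using u that unfolding plurisubharmonic_on_def by blast
    then show ?thesis
      unfolding v_def by (cases "u x") (auto simp: max_def)
  qed
  show "real_psh \<Omega> v"
    unfolding real_psh_def
  proof (intro conjI ballI allI impI)
    fix x t assume x: "x \<in> \<Omega>" "v x < t"
    then have "max (u x) (ereal (- N)) < ereal t"
      by (simp flip: v)
    then have *: "u x < ereal t" "- N < t"
      by auto
    have "openin (top_of_set \<Omega>) {z \<in> \<Omega>. u z < ereal t}"
      using u unfolding plurisubharmonic_on_def usc_on_def by blast
    then have "open {z \<in> \<Omega>. u z < ereal t}"
      using \<open>open \<Omega>\<close> openin_open_eq by blast
    then have "\<forall>\<^sub>F y in nhds x. y \<in> {z \<in> \<Omega>. u z < ereal t}"
      using x * by (intro eventually_nhds_in_open) auto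
    then show "\<forall>\<^sub>F y in nhds x. v y < t"
    proof eventually_elim
      case (elim y)
      then have "max (u y) (ereal (- N)) < ereal t"
        using *(2) by auto
      then show ?case
        using v[of y] elim by (metis (no_types, lifting) ereal_less_ereal_Ex less_ereal.simps(1) mem_Collect_eq)
    qed
  next
    fix x w r G
    assume r: "(0::real) < r" and sub: "\<forall>\<zeta>\<in>cball 0 r. x + \<zeta> *s w \<in> \<Omega>" and G: "G holomorphic_on cball 0 r"
      and le: "\<forall>\<zeta>. norm \<zeta> = r \<longrightarrow> v (x + \<zeta> *s w) \<le> Re (G \<zeta>)"
    have x: "x \<in> \<Omega>"
      using bspec[OF sub, of 0] r by simp
    have circ: "x + \<zeta> *s w \<in> \<Omega>" if "norm \<zeta> = r" for \<zeta>
      using bspec[OF sub, of \<zeta>] that by simp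
    have "u (x + 0 *s w) \<le> ereal (Re (G 0))"
    proof (rule subharmonic_on_le_harmonic[OF _ _ r G])
      show "subharmonic_on {\<zeta>. x + \<zeta> *s w \<in> \<Omega>} (\<lambda>\<zeta>. u (x + \<zeta> *s w))"
        using u unfolding plurisubharmonic_on_def by blast
      show "cball 0 r \<subseteq> {\<zeta>. x + \<zeta> *s w \<in> \<Omega>}"
        using sub by auto
      fix \<zeta> :: complex assume \<zeta>: "norm (\<zeta> - 0) = r"
      have "u (x + \<zeta> *s w) \<le> ereal (v (x + \<zeta> *s w))"
        using v[OF circ] \<zeta> by simp
      also have "\<dots> \<le> ereal (Re (G \<zeta>))"
        using le \<zeta> by simp
      finally show "u (x + \<zeta> *s w) \<le> ereal (Re (G \<zeta>))" .
    qed
    moreover have "- N \<le> Re (G 0)"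
    proof -
      have I1: "((\<lambda>\<theta>. Re (G (0 + of_real r * cis \<theta>))) has_integral Re (of_real (2 * pi) * G 0)) {0..2*pi}"
        using has_integral_linear[OF mean_value_holomorphic[OF G r] bounded_linear_Re] by (simp add: o_def)
      have I2: "((\<lambda>\<theta>::real. - N) has_integral (2 * pi) * (- N)) {0..2*pi}"
        using has_integral_const_real[of "- N" 0 "2*pi"] by simp
      have "- N \<le> Re (G (0 + of_real r * cis \<theta>))" for \<theta>
      proof -
        have n: "norm (of_real r * cis \<theta>) = r"
          using r by (simp add: norm_mult)
        have "ereal (- N) \<le> ereal (v (x + (of_real r * cis \<theta>) *s w))"
          using v[OF circ[OF n]] by simp
        with le n show ?thesis
          by (metis add_0 ereal_less_eq(3) order_trans)
      qed
      then have "(2 * pi) * (- N) \<le> Re (of_real (2 * pi) * G 0)"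
        by (intro has_integral_le[OF I2 I1])
      then have "pi * (- N) \<le> pi * Re (G 0)"
        by (simp add: mult.commute)
      then show ?thesis
        by (rule mult_left_le_imp_le) simp
    qed
    ultimately have "max (u x) (ereal (- N)) \<le> ereal (Re (G 0))"
      by simp
    then show "v x \<le> Re (G 0)"
      unfolding v[OF x, symmetric] by simp
  qed
qed

text \<open>
  A plurisubharmonic function obeys the maximum principle relative to a harmonic function along
  every holomorphic disc, although its definition speaks of complex lines only. Truncation below the
  minimum of \<open>H\<close> affects neither hypothesis nor conclusion.
\<close>

theorem psh_maximum_principle_along_disc:
  fixes f :: "complex \<Rightarrow> complex ^ 'n"
  assumes u: "plurisubharmonic_on \<Omega> u" and op: "open \<Omega>" "open S"
    and bd: "\<And>x. x \<in> \<Omega> \<Longrightarrow> u x \<le> 0"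
    and K: "compact K" "K \<subseteq> S"
    and hol: "\<And>i. (\<lambda>\<xi>. f \<xi> $ i) holomorphic_on S" and f: "f ` S \<subseteq> \<Omega>"
    and H: "continuous_on K H"
    and harm: "\<And>q. q \<in> interior K \<Longrightarrow>
        \<exists>e>0. \<exists>L. L holomorphic_on ball q e \<and> (\<forall>\<zeta>\<in>ball q e. H \<zeta> = Re (L \<zeta>))"
    and fr: "\<And>\<zeta>. \<zeta> \<in> frontier K \<Longrightarrow> u (f \<zeta>) \<le> ereal (H \<zeta>)"
    and p: "p \<in> K"
  shows "u (f p) \<le> ereal (H p)"
proof -
  obtain N where N: "\<And>\<zeta>. \<zeta> \<in> K \<Longrightarrow> \<bar>H \<zeta>\<bar> \<le> N"
    using compact_imp_bounded[OF compact_continuous_image[OF H K(1)]]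
    unfolding bounded_iff by auto
  have "N \<ge> 0"
    using N[OF p] by linarith
  define v where "v z = real_of_ereal (max (u z) (ereal (- N)))" for z
  have v: "real_psh \<Omega> v" "\<And>x. x \<in> \<Omega> \<Longrightarrow> ereal (v x) = max (u x) (ereal (- N))"
    using real_psh_truncation[OF u op(1), where N = N] unfolding v_def by auto
  have f\<Omega>: "f \<zeta> \<in> \<Omega>" if "\<zeta> \<in> K" for \<zeta>
    using f K that by auto
  have frK: "frontier K \<subseteq> K"
    using K(1) compact_imp_closed frontier_subset_closed by blast
  have "v (f p) \<le> H p"
  proof (rule real_psh_maximum_principle[OF v(1) op _ K hol f H harm _ p])
    fix x assume "x \<in> \<Omega>"
    then have "ereal (v x) \<le> 0"
      using v(2) bd \<open>N \<ge> 0\<close> by simp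
    then show "v x \<le> 0" by simp
  next
    fix \<zeta> assume \<zeta>: "\<zeta> \<in> frontier K"
    then have "\<zeta> \<in> K" using frK by auto
    have "ereal (v (f \<zeta>)) \<le> ereal (H \<zeta>)"
      unfolding v(2)[OF f\<Omega>[OF \<open>\<zeta> \<in> K\<close>]] using fr[OF \<zeta>] N[OF \<open>\<zeta> \<in> K\<close>] by simp
    then show "v (f \<zeta>) \<le> H \<zeta>" by simp
  qed auto
  then have "ereal (v (f p)) \<le> ereal (H p)" by simp
  then show ?thesis
    unfolding v(2)[OF f\<Omega>[OF p]] by simp
qed

text \<open>
  Near \<open>q\<close> the quotient \<open>B \<zeta> / B q\<close> stays in the right half-plane, where the principal logarithm is
  holomorphic.
\<close>

lemma ln_norm_holomorphic_locally_harmonic: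
  assumes B: "B holomorphic_on S" "open S" "q \<in> S" "B q \<noteq> 0"
  shows "\<exists>e>0. \<exists>L. L holomorphic_on ball q e \<and> (\<forall>\<zeta>\<in>ball q e. c * ln (norm (B \<zeta>)) + d = Re (L \<zeta>))"
proof -
  obtain e1 where e1: "e1 > 0" "ball q e1 \<subseteq> S"
    using B open_contains_ball by blast
  have "isCont B q"
    using B(1-3) continuous_on_eq_continuous_at holomorphic_on_imp_continuous_on by blast
  then obtain e2 where e2: "e2 > 0" "\<And>\<zeta>. dist \<zeta> q < e2 \<Longrightarrow> dist (B \<zeta>) (B q) < norm (B q)"
    unfolding continuous_at_eps_delta using B(4) by (metis zero_less_norm_iff)
  define e where "e = min e1 e2"
  have e: "e > 0" "ball q e \<subseteq> S"
    using e1 e2 by (auto simp: e_def)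
  have pos: "Re (B \<zeta> / B q) > 0" if "\<zeta> \<in> ball q e" for \<zeta>
  proof -
    have "norm (B \<zeta> / B q - 1) = dist (B \<zeta>) (B q) / norm (B q)"
      using B(4) by (simp add: dist_norm field_simps flip: norm_divide)
    also have "\<dots> < 1"
      using e2(2)[of \<zeta>] that B(4) by (simp add: e_def dist_commute)
    finally show ?thesis
      using abs_Re_le_cmod[of "B \<zeta> / B q - 1"] by simp
  qed
  define L where "L \<zeta> = of_real c * (Ln (B \<zeta> / B q) + Ln (B q)) + of_real d" for \<zeta>
  have "B \<zeta> / B q \<notin> \<real>\<^sub>\<le>\<^sub>0" if "\<zeta> \<in> ball q e" for \<zeta>
    using pos[OF that] by (auto simp: complex_nonpos_Reals_iff)
  then have "L holomorphic_on ball q e"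
    unfolding L_def
    by (intro holomorphic_intros holomorphic_on_subset[OF B(1) e(2)] B(4)) auto
  moreover have "c * ln (norm (B \<zeta>)) + d = Re (L \<zeta>)" if "\<zeta> \<in> ball q e" for \<zeta>
  proof -
    have "B \<zeta> \<noteq> 0"
      using pos[OF that] by auto
    then show ?thesis
      using B(4) by (simp add: L_def norm_divide ln_div)
  qed
  ultimately show ?thesis
    using e(1) by blast
qed

text \<open>
  Here \<open>B\<close> plays the role of a finite Blaschke product whose zeros carry the logarithmic poles of
  \<open>u \<circ> f\<close>. The additive constant at the poles is removed by comparing with
  \<open>(1 - \<eta>) * ln (norm (B \<zeta>)) + \<eta>\<close>: close to a zero of \<open>B\<close> the weaker singularity dominates any
  constant, close to the unit circle the summand \<open>\<eta>\<close> makes the comparison function nonnegative.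
\<close>

proposition psh_le_ln_along_disc:
  fixes f :: "complex \<Rightarrow> complex ^ 'n"
  assumes u: "plurisubharmonic_on \<Omega> u" and op: "open \<Omega>"
    and neg: "\<And>x. x \<in> \<Omega> \<Longrightarrow> u x \<le> 0"
    and hol: "\<And>i. (\<lambda>\<xi>. f \<xi> $ i) holomorphic_on ball 0 1" and f: "f ` ball 0 1 \<subseteq> \<Omega>"
    and B: "B holomorphic_on ball 0 1"
    and bdry: "\<And>\<eta>. 0 < \<eta> \<Longrightarrow> \<exists>s<1. \<forall>\<zeta>. s \<le> norm \<zeta> \<longrightarrow> norm \<zeta> < 1 \<longrightarrow> exp (- \<eta>) \<le> norm (B \<zeta>)"
    and pole: "0 < \<epsilon>" "\<And>\<zeta>. norm \<zeta> < 1 \<Longrightarrow> 0 < norm (B \<zeta>) \<Longrightarrow> norm (B \<zeta>) < \<epsilon> \<Longrightarrow>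
        u (f \<zeta>) \<le> ereal (ln (norm (B \<zeta>)) + C)"
    and p: "norm p < 1" "B p \<noteq> 0"
  shows "u (f p) \<le> ereal (ln (norm (B p)))"
proof -
  have main: "u (f p) \<le> ereal ((1 - \<eta>) * ln (norm (B p)) + \<eta>)" if \<eta>: "0 < \<eta>" "\<eta> < 1" for \<eta>
  proof -
    obtain s1 where s1: "s1 < 1" "\<And>\<zeta>. s1 \<le> norm \<zeta> \<Longrightarrow> norm \<zeta> < 1 \<Longrightarrow> exp (- \<eta>) \<le> norm (B \<zeta>)"
      using bdry[OF \<eta>(1)] by blast
    define s where "s = max s1 (norm p)"
    have s: "s < 1" "norm p \<le> s" "s1 \<le> s"
      using s1 p by (auto simp: s_def)
    \<comment> \<open>The last bound is what makes \<open>ln t + C \<le> (1 - \<eta>) * ln t\<close>.\<close>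
    define t where "t = Min {\<epsilon> / 2, norm (B p), exp (- C / \<eta>)}"
    have t: "0 < t" "t < \<epsilon>" "t \<le> norm (B p)" "t \<le> exp (- C / \<eta>)"
      unfolding t_def using pole(1) p(2) by auto
    define K where "K = {\<zeta> \<in> cball 0 s. norm (B \<zeta>) \<in> {t..}}"
    define H where "H \<zeta> = (1 - \<eta>) * ln (norm (B \<zeta>)) + \<eta>" for \<zeta>
    have K1: "cball (0::complex) s \<subseteq> ball 0 1"
      using s by auto
    have cB: "continuous_on (ball 0 1) (\<lambda>\<zeta>. norm (B \<zeta>))"
      by (intro continuous_intros holomorphic_on_imp_continuous_on B)
    have clK: "closed K"
      using continuous_closed_preimage[OF continuous_on_subset[OF cB K1] closed_cball closed_atLeast]
      by (simp add: K_def vimage_def Int_def)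
    moreover have "bounded K"
      by (rule bounded_subset[OF bounded_cball[of 0 s]]) (auto simp: K_def)
    ultimately have "compact K"
      by (simp add: compact_eq_bounded_closed)
    have KS: "K \<subseteq> ball 0 1"
      using K1 by (auto simp: K_def)
    have KB: "B \<zeta> \<noteq> 0" if "\<zeta> \<in> K" for \<zeta>
      using that t(1) by (auto simp: K_def)
    have frK: "norm \<zeta> = s \<or> norm (B \<zeta>) = t" if "\<zeta> \<in> frontier K" for \<zeta>
    proof (rule ccontr)
      assume *: "\<not> (norm \<zeta> = s \<or> norm (B \<zeta>) = t)"
      have "\<zeta> \<in> K"
        using that clK frontier_subset_closed by blast
      let ?O = "ball 0 s \<inter> (\<lambda>\<zeta>. norm (B \<zeta>)) -` {t<..}"
      have "open ?O"
        by (intro continuous_open_preimage continuous_on_subset[OF cB] open_ball open_greaterThan)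
           (use s in auto)
      moreover have "\<zeta> \<in> ?O" "?O \<subseteq> K"
        using \<open>\<zeta> \<in> K\<close> * by (auto simp: K_def)
      ultimately have "\<zeta> \<in> interior K"
        by (meson interiorI)
      with that show False
        by (simp add: frontier_def)
    qed
    have "u (f p) \<le> ereal (H p)"
    proof (rule psh_maximum_principle_along_disc[OF u op open_ball neg \<open>compact K\<close> KS hol f])
      show "continuous_on K H"
        unfolding H_def using KB
        by (intro continuous_intros holomorphic_on_imp_continuous_on holomorphic_on_subset[OF B KS]) auto
      show "\<exists>e>0. \<exists>L. L holomorphic_on ball q e \<and> (\<forall>\<zeta>\<in>ball q e. H \<zeta> = Re (L \<zeta>))"
        if "q \<in> interior K" for q
        unfolding H_def
        by (rule ln_norm_holomorphic_locally_harmonic[OF B open_ball])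
           (use that interior_subset KS KB in blast)+
      show "p \<in> K"
        using s t by (simp add: K_def)
      fix \<zeta> assume \<zeta>: "\<zeta> \<in> frontier K"
      then have "\<zeta> \<in> K"
        using clK frontier_subset_closed by blast
      then have n1: "norm \<zeta> < 1"
        using KS by auto
      from frK[OF \<zeta>] show "u (f \<zeta>) \<le> ereal (H \<zeta>)"
      proof
        assume "norm \<zeta> = s"
        then have "ln (exp (- \<eta>)) \<le> ln (norm (B \<zeta>))"
          using s1(2)[of \<zeta>] s n1 KB[OF \<open>\<zeta> \<in> K\<close>] by (subst ln_le_cancel_iff) auto
        then have "(1 - \<eta>) * (- \<eta>) \<le> (1 - \<eta>) * ln (norm (B \<zeta>))"
          using \<eta> by (intro mult_left_mono) auto
        moreover have "(1 - \<eta>) * (- \<eta>) + \<eta> \<ge> 0"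
          using \<eta> by (simp add: algebra_simps)
        ultimately have "0 \<le> H \<zeta>"
          unfolding H_def by linarith
        moreover have "u (f \<zeta>) \<le> 0"
          using neg[of "f \<zeta>"] f n1 by (auto simp: image_subset_iff)
        ultimately show ?thesis
          by (metis ereal_less_eq(3) order_trans zero_ereal_def)
      next
        assume Bt: "norm (B \<zeta>) = t"
        have "ln t \<le> - C / \<eta>"
          using t by (metis ln_exp ln_le_cancel_iff exp_gt_zero)
        then have "\<eta> * ln t \<le> - C"
          using \<eta> by (simp add: field_simps)
        then have "ln t + C \<le> H \<zeta>"
          unfolding H_def Bt using \<eta> by (simp add: algebra_simps)
        moreover have "u (f \<zeta>) \<le> ereal (ln t + C)"
          using pole(2)[of \<zeta>] n1 Bt t by simp
        ultimately show ?thesis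
          by (meson ereal_less_eq(3) order_trans)
      qed
    qed
    then show ?thesis
      by (simp add: H_def)
  qed
  show ?thesis
  proof (rule tendsto_le[of "at_right (0::real)"])
    have "((\<lambda>\<eta>. (1 - \<eta>) * ln (norm (B p)) + \<eta>) \<longlongrightarrow> ln (norm (B p))) (at_right 0)"
      by (rule tendsto_eq_intros refl | simp)+
    then show "((\<lambda>\<eta>. ereal ((1 - \<eta>) * ln (norm (B p)) + \<eta>)) \<longlongrightarrow> ereal (ln (norm (B p)))) (at_right 0)"
      by simp
    show "((\<lambda>_. u (f p)) \<longlongrightarrow> u (f p)) (at_right 0)"
      by simp
    have "eventually (\<lambda>\<eta>. \<eta> \<in> {0<..<1::real}) (at_right 0)"
      by (rule eventually_at_rightI[of 0 1]) auto
    then show "eventually (\<lambda>\<eta>. u (f p) \<le> ereal ((1 - \<eta>) * ln (norm (B p)) + \<eta>)) (at_right 0)"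
      by eventually_elim (use main in auto)
  qed simp
qed

section \<open>The Schwarz and Schwarz-Pick lemmas\<close>

abbreviation mob :: "complex \<Rightarrow> complex \<Rightarrow> complex" where
  "mob \<equiv> Moebius_function 0"

lemma one_minus_cnj_mult_nonzero:
  assumes "norm w < 1" "norm z < 1"
  shows "1 - cnj w * z \<noteq> 0"
proof
  assume "1 - cnj w * z = 0"
  then have "norm (cnj w * z) = 1"
    by (metis eq_iff_diff_eq_0 norm_one)
  moreover have "norm (cnj w * z) < 1"
    using norm_mult_less[of "cnj w" 1 z 1] assms by simp
  ultimately show False by simp
qed

lemma pseudohyperbolic_identity:
  fixes w z :: complex
  shows "(norm (1 - cnj w * z))\<^sup>2 - (norm (z - w))\<^sup>2 = (1 - (norm w)\<^sup>2) * (1 - (norm z)\<^sup>2)"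
  unfolding cmod_power2 by (simp add: power2_eq_square algebra_simps)

text \<open>
  For maps into the closed disc; the factors \<open>s < 1\<close> reduce it to the Schwarz lemma for the open disc.
\<close>

lemma Schwarz_factor_0:
  assumes F: "F holomorphic_on ball 0 1" and le: "\<And>z. norm z < 1 \<Longrightarrow> norm (F z) \<le> 1" and "F 0 = 0"
  obtains G where "G holomorphic_on ball 0 1" "\<And>z. norm z < 1 \<Longrightarrow> norm (G z) \<le> 1"
    "\<And>z. norm z < 1 \<Longrightarrow> F z = z * G z"
proof -
  obtain h where h: "h holomorphic_on ball 0 1" "\<And>z. norm z < 1 \<Longrightarrow> F z = z * h z" "deriv F 0 = h 0"
    using Schwarz3[OF F \<open>F 0 = 0\<close>] by metis
  have "norm (h z) \<le> 1" if z: "norm z < 1" for z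
  proof (rule field_le_mult_one_interval)
    fix s :: real assume s: "0 < s" "s < 1"
    let ?F = "\<lambda>z. of_real s * F z"
    have holo: "?F holomorphic_on ball 0 1"
      by (intro holomorphic_intros F)
    have lt: "norm (?F z) < 1" if "norm z < 1" for z
    proof -
      have "norm (?F z) \<le> s * 1"
        unfolding norm_mult using s le[OF that] by (intro mult_mono) auto
      then show ?thesis using s by simp
    qed
    have F0: "?F 0 = 0"
      using \<open>F 0 = 0\<close> by simp
    show "s * norm (h z) \<le> 1"
    proof (cases "z = 0")
      case True
      have "deriv ?F 0 = of_real s * h 0"
        using h(3) holomorphic_on_imp_differentiable_at[OF F] by (subst deriv_cmult) auto
      with Schwarz_Lemma(2)[OF holo F0 lt z] True s show ?thesis
        by (simp add: norm_mult)
    next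
      case False
      have "norm (?F z) \<le> norm z"
        by (rule Schwarz_Lemma(1)[OF holo F0 lt z])
      then show ?thesis
        using False s by (simp add: h(2)[OF z] norm_mult)
    qed
  qed
  with h that show ?thesis by blast
qed

lemma Schwarz_factor:
  assumes F: "F holomorphic_on ball 0 1" and le: "\<And>z. norm z < 1 \<Longrightarrow> norm (F z) \<le> 1"
    and w: "norm w < 1" "F w = 0"
  obtains G where "G holomorphic_on ball 0 1" "\<And>z. norm z < 1 \<Longrightarrow> norm (G z) \<le> 1"
    "\<And>z. norm z < 1 \<Longrightarrow> F z = mob w z * G z"
proof -
  have im: "mob v ` ball 0 1 \<subseteq> ball 0 1" if "norm v < 1" for v
    using Moebius_function_norm_lt_1[OF that] by auto
  have h1: "F \<circ> mob (-w) holomorphic_on ball 0 1"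
    by (rule holomorphic_on_compose_gen[OF Moebius_function_holomorphic F im]) (use w in auto)
  have h2: "norm ((F \<circ> mob (-w)) z) \<le> 1" if "norm z < 1" for z
    using le Moebius_function_norm_lt_1[of "-w" z] that w by simp
  have h3: "(F \<circ> mob (-w)) 0 = 0"
    using w by (simp add: Moebius_function_of_zero)
  obtain G where G: "G holomorphic_on ball 0 1" "\<And>z. norm z < 1 \<Longrightarrow> norm (G z) \<le> 1"
    "\<And>z. norm z < 1 \<Longrightarrow> (F \<circ> mob (-w)) z = z * G z"
    using Schwarz_factor_0[OF h1 h2 h3] by metis
  show ?thesis
  proof (rule that[of "G \<circ> mob w"])
    show "G \<circ> mob w holomorphic_on ball 0 1"
      by (rule holomorphic_on_compose_gen[OF Moebius_function_holomorphic[OF w(1)] G(1) im[OF w(1)]])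
    show "norm ((G \<circ> mob w) z) \<le> 1" if "norm z < 1" for z
      using G(2) Moebius_function_norm_lt_1[OF w(1) that] by simp
    show "F z = mob w z * (G \<circ> mob w) z" if "norm z < 1" for z
      using G(3)[OF Moebius_function_norm_lt_1[OF w(1) that, of 0]] Moebius_function_compose[of "-w" w z] w that
      by simp
  qed
qed

text \<open>
  Both zeros are divided out one after the other as Blaschke factors.
\<close>

lemma norm_at_0_le_prod_zeros:
  assumes F: "F holomorphic_on ball 0 1" and le: "\<And>z. norm z < 1 \<Longrightarrow> norm (F z) \<le> 1"
    and "norm x < 1" "norm y < 1" "F x = 0" "F y = 0" "x \<noteq> y"
  shows "norm (F 0) \<le> norm x * norm y"
proof -
  obtain G where G: "G holomorphic_on ball 0 1" "\<And>z. norm z < 1 \<Longrightarrow> norm (G z) \<le> 1"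
    "\<And>z. norm z < 1 \<Longrightarrow> F z = mob x z * G z"
    using Schwarz_factor[OF F le] assms by metis
  have "mob x y \<noteq> 0"
    using assms one_minus_cnj_mult_nonzero[of x y] by (simp add: Moebius_function_simple)
  then have "G y = 0"
    using G(3)[of y] assms by simp
  then obtain G' where G': "\<And>z. norm z < 1 \<Longrightarrow> norm (G' z) \<le> 1"
    "\<And>z. norm z < 1 \<Longrightarrow> G z = mob y z * G' z"
    using Schwarz_factor[OF G(1,2)] assms by metis
  have "norm (F 0) = norm x * norm y * norm (G' 0)"
    using G(3)[of 0] G'(2)[of 0] by (simp add: Moebius_function_of_zero norm_mult)
  also have "\<dots> \<le> norm x * norm y * 1"
    using G'(1)[of 0] by (intro mult_left_mono) auto
  finally show ?thesis by simp
qed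

lemma Schwarz_Pick_strict:
  assumes G: "G holomorphic_on ball 0 1" and lt: "\<And>z. norm z < 1 \<Longrightarrow> norm (G z) < 1"
    and x: "norm x < 1" and y: "norm y < 1"
  shows "norm (G x - G y) * norm (1 - cnj y * x) \<le> norm (x - y) * norm (1 - cnj (G y) * G x)"
proof -
  have im: "G ` ball 0 1 \<subseteq> ball 0 1"
    using lt by auto
  have "mob (G y) \<circ> G holomorphic_on ball 0 1"
    by (rule holomorphic_on_compose_gen[OF G Moebius_function_holomorphic im]) (use lt y in auto)
  moreover have "norm ((mob (G y) \<circ> G) z) \<le> 1" if "norm z < 1" for z
    using Moebius_function_norm_lt_1[OF lt lt] that y by (simp add: less_imp_le)
  moreover have "(mob (G y) \<circ> G) y = 0"
    by (simp add: Moebius_function_eq_zero)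
  ultimately obtain K where K: "\<And>z. norm z < 1 \<Longrightarrow> norm (K z) \<le> 1"
    "\<And>z. norm z < 1 \<Longrightarrow> (mob (G y) \<circ> G) z = mob y z * K z"
    using Schwarz_factor[of "mob (G y) \<circ> G" y] y by metis
  have "norm (mob (G y) (G x)) = norm (mob y x) * norm (K x)"
    using K(2)[OF x] by (simp add: norm_mult)
  also have "\<dots> \<le> norm (mob y x) * 1"
    by (intro mult_left_mono K x) auto
  finally have "norm (G x - G y) / norm (1 - cnj (G y) * G x) \<le> norm (x - y) / norm (1 - cnj y * x)"
    by (simp add: Moebius_function_simple norm_divide)
  then show ?thesis
    using one_minus_cnj_mult_nonzero[OF y x] one_minus_cnj_mult_nonzero[OF lt lt, OF y x]
    by (simp add: field_simps)
qed

text \<open>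
  The closed-disc version, needed because dividing a self-map of the disc by a Blaschke factor may
  give a unimodular constant.
\<close>

lemma Schwarz_Pick:
  assumes G: "G holomorphic_on ball 0 1" and le: "\<And>z. norm z < 1 \<Longrightarrow> norm (G z) \<le> 1"
    and x: "norm x < 1" and y: "norm y < 1"
  shows "norm (G x - G y) * norm (1 - cnj y * x) \<le> norm (x - y) * norm (1 - cnj (G y) * G x)"
proof (rule tendsto_le[of "at_left (1::real)"])
  let ?L = "\<lambda>s::real. norm (of_real s * G x - of_real s * G y) * norm (1 - cnj y * x)"
  let ?R = "\<lambda>s::real. norm (x - y) * norm (1 - cnj (of_real s * G y) * (of_real s * G x))"
  show "(?L \<longlongrightarrow> norm (G x - G y) * norm (1 - cnj y * x)) (at_left 1)"
    by (rule tendsto_eq_intros refl | simp)+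
  show "(?R \<longlongrightarrow> norm (x - y) * norm (1 - cnj (G y) * G x)) (at_left 1)"
    by (rule tendsto_eq_intros refl | simp)+
  have "eventually (\<lambda>s. s \<in> {0<..<1::real}) (at_left 1)"
    by (rule eventually_at_leftI[of 0]) auto
  then show "eventually (\<lambda>s. ?L s \<le> ?R s) (at_left 1)"
  proof eventually_elim
    case (elim s)
    show ?case
    proof (rule Schwarz_Pick_strict[where G = "\<lambda>z. of_real s * G z"])
      show "(\<lambda>z. of_real s * G z) holomorphic_on ball 0 1"
        by (intro holomorphic_intros G)
      fix z :: complex assume "norm z < 1"
      then have "norm (of_real s * G z) \<le> s * 1"
        unfolding norm_mult using elim le by (intro mult_mono) auto
      then show "norm (of_real s * G z) < 1"
        using elim by simp
    qed (use x y in auto)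
  qed
qed auto

text \<open>
  The quotient \<open>F z / z\<close> is a map into the closed disc with moduli \<open>p\<close> and \<open>q\<close> at \<open>x\<close> and \<open>y\<close>. If
  \<open>F\<close> is nearly extremal for the Schwarz lemma at \<open>y\<close>, that is \<open>q\<close> near \<open>1\<close>, then it is nearly
  extremal at \<open>x\<close> as well, provided \<open>x\<close> and \<open>y\<close> stay away from the unit circle. The inequality
  quantifies this; it is the Schwarz-Pick inequality for \<open>F z / z\<close> rewritten with the identity for
  the pseudohyperbolic distance.
\<close>

lemma three_point_Schwarz_Pick:
  assumes F: "F holomorphic_on ball 0 1" and le: "\<And>z. norm z < 1 \<Longrightarrow> norm (F z) \<le> 1" and F0: "F 0 = 0"
    and x: "norm x < 1" "x \<noteq> 0" and y: "norm y < 1" "y \<noteq> 0"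
  defines "p \<equiv> norm (F x) / norm x" and "q \<equiv> norm (F y) / norm y"
  shows "(1 - (norm x)\<^sup>2) * (1 - (norm y)\<^sup>2) * (1 - p * q)\<^sup>2 \<le> 4 * ((1 - p\<^sup>2) * (1 - q\<^sup>2))" "p \<le> 1" "q \<le> 1"
proof -
  obtain G where G: "G holomorphic_on ball 0 1" "\<And>z. norm z < 1 \<Longrightarrow> norm (G z) \<le> 1"
    "\<And>z. norm z < 1 \<Longrightarrow> F z = z * G z"
    using Schwarz_factor_0[OF F le F0] by metis
  have pq: "p = norm (G x)" "q = norm (G y)"
    using G(3)[of x] G(3)[of y] x y by (auto simp: p_def q_def norm_mult)
  show "p \<le> 1" "q \<le> 1"
    unfolding pq using G(2) x y by auto
  define A B C D where "A = (norm (1 - cnj y * x))\<^sup>2" and "B = (norm (x - y))\<^sup>2"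
    and "C = (norm (1 - cnj (G y) * G x))\<^sup>2" and "D = (norm (G x - G y))\<^sup>2"
  have AB: "A - B = (1 - (norm x)\<^sup>2) * (1 - (norm y)\<^sup>2)"
    unfolding A_def B_def pseudohyperbolic_identity by simp
  have CD: "C - D = (1 - p\<^sup>2) * (1 - q\<^sup>2)"
    unfolding C_def D_def pseudohyperbolic_identity pq by simp
  have "D * A \<le> B * C"
    unfolding A_def B_def C_def D_def power_mult_distrib[symmetric]
    by (intro power_mono Schwarz_Pick G x y) auto
  have AB0: "0 \<le> A - B"
    unfolding AB using x y by (simp add: power_le_one abs_square_le_1)
  have CD0: "0 \<le> C - D"
    unfolding CD pq using G(2) x y by (simp add: power_le_one)
  have "norm (1 - cnj y * x) \<le> 1 + norm y * norm x"
    using norm_triangle_ineq4[of 1 "cnj y * x"] by (simp add: norm_mult)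
  also have "\<dots> \<le> 1 + 1 * 1"
    using x y by (intro add_left_mono mult_mono) auto
  finally have "A \<le> 2\<^sup>2"
    unfolding A_def by (intro power_mono) auto
  have "1 - p * q \<le> norm (1 - cnj (G y) * G x)"
    using norm_triangle_ineq2[of 1 "cnj (G y) * G x"] unfolding pq by (simp add: norm_mult mult.commute)
  moreover have "0 \<le> 1 - p * q"
    using \<open>p \<le> 1\<close> \<open>q \<le> 1\<close> mult_mono[of p 1 q 1] unfolding pq by simp
  ultimately have "(1 - p * q)\<^sup>2 \<le> C"
    unfolding C_def by (intro power_mono)
  then have "(A - B) * (1 - p * q)\<^sup>2 \<le> (A - B) * C"
    using AB0 by (intro mult_left_mono)
  also have "\<dots> \<le> A * (C - D)"
    using \<open>D * A \<le> B * C\<close> by (simp add: algebra_simps)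
  also have "\<dots> \<le> 4 * (C - D)"
    using CD0 \<open>A \<le> 2\<^sup>2\<close> by (intro mult_right_mono) auto
  finally show "(1 - (norm x)\<^sup>2) * (1 - (norm y)\<^sup>2) * (1 - p * q)\<^sup>2 \<le> 4 * ((1 - p\<^sup>2) * (1 - q\<^sup>2))"
    unfolding AB CD .
qed

text \<open>
  In the application \<open>\<alpha>\<close> and \<open>\<beta>\<close> are the moduli of the first coordinates of the poles, \<open>s\<close> and
  \<open>t\<close> the moduli of the parameters belonging to them. If \<open>s * t\<^sup>2\<close> were close to its lower bound
  \<open>\<tau> * \<beta>\<^sup>2\<close>, then \<open>t\<close> would be close to \<open>\<beta>\<close> and \<open>s\<close> close to \<open>\<tau>\<close>; in the limit the last
  hypothesis would read \<open>(1 - \<tau>\<^sup>2) * (1 - \<beta>\<^sup>2) * (1 - \<alpha> / \<tau>)\<^sup>2 \<le> 0\<close>, which is absurd because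
  \<open>\<alpha> < \<tau>\<close>.
\<close>

lemma parameter_gap:
  fixes \<alpha> \<beta> \<tau> :: real
  assumes "0 < \<alpha>" "\<alpha> < \<tau>" "\<tau> < 1" "0 < \<beta>" "\<beta> < 1"
  obtains K where "1 < K"
    "\<And>s t. 0 < s \<Longrightarrow> \<beta> \<le> t \<Longrightarrow> \<tau> * \<beta> \<le> s * t \<Longrightarrow>
       (1 - s\<^sup>2) * (1 - t\<^sup>2) * (1 - (\<alpha> / s) * (\<beta> / t))\<^sup>2 \<le> 4 * ((1 - (\<alpha> / s)\<^sup>2) * (1 - (\<beta> / t)\<^sup>2)) \<Longrightarrow>
       K * (\<tau> * \<beta>\<^sup>2) \<le> s * t\<^sup>2"
proof -
  let ?R = "\<lambda>K. (1 - (\<tau> * K)\<^sup>2) * (1 - (\<beta> * K)\<^sup>2) * (1 - \<alpha> * K / \<tau>)\<^sup>2"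
  let ?F = "\<lambda>K. ?R K - 4 * (1 - (1 / K)\<^sup>2)"
  have sq: "\<tau>\<^sup>2 < 1" "\<beta>\<^sup>2 < 1"
    using assms by (auto simp: power_less_one_iff abs_square_less_1)
  have "(?F \<longlongrightarrow> ?F 1) (at_right 1)"
    using assms by (intro tendsto_intros) auto
  moreover have "?F 1 > 0"
    using assms sq by simp
  ultimately have 1: "\<forall>\<^sub>F K in at_right 1. ?F K > 0"
    by (rule order_tendstoD)
  have "((\<lambda>K. \<tau> * K) \<longlongrightarrow> \<tau> * 1) (at_right 1)" "((\<lambda>K. \<beta> * K) \<longlongrightarrow> \<beta> * 1) (at_right 1)"
    "((\<lambda>K. \<alpha> * K / \<tau>) \<longlongrightarrow> \<alpha> * 1 / \<tau>) (at_right 1)"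
    using assms by (intro tendsto_intros; simp)+
  note lims = this
  have 2: "\<forall>\<^sub>F K in at_right 1. \<tau> * K < 1" "\<forall>\<^sub>F K in at_right 1. \<beta> * K < 1"
    "\<forall>\<^sub>F K in at_right 1. \<alpha> * K / \<tau> < 1"
    by (rule order_tendstoD(2)[OF lims(1)] order_tendstoD(2)[OF lims(2)] order_tendstoD(2)[OF lims(3)], use assms in simp)+
  have 3: "\<forall>\<^sub>F K in at_right 1. K > (1::real)"
    by (simp add: eventually_at_right_less)
  have "\<forall>\<^sub>F K in at_right 1. ?F K > 0 \<and> \<tau> * K < 1 \<and> \<beta> * K < 1 \<and> \<alpha> * K / \<tau> < 1 \<and> K > 1"
    by (intro eventually_conj 1 2 3)
  then obtain K where K: "?F K > 0" "\<tau> * K < 1" "\<beta> * K < 1" "\<alpha> * K / \<tau> < 1" "K > 1"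
    using eventually_happens'[OF trivial_limit_at_right_real] by blast
  show ?thesis
  proof (rule that[OF \<open>K > 1\<close>], rule ccontr)
    fix s t :: real
    assume s: "0 < s" and t: "\<beta> \<le> t" and st: "\<tau> * \<beta> \<le> s * t"
      and le: "(1 - s\<^sup>2) * (1 - t\<^sup>2) * (1 - (\<alpha> / s) * (\<beta> / t))\<^sup>2 \<le> 4 * ((1 - (\<alpha> / s)\<^sup>2) * (1 - (\<beta> / t)\<^sup>2))"
      and "\<not> K * (\<tau> * \<beta>\<^sup>2) \<le> s * t\<^sup>2"
    then have lt: "s * t\<^sup>2 < K * (\<tau> * \<beta>\<^sup>2)" by simp
    have t0: "t > 0" using t assms by simp
    have "(\<tau> * \<beta>) * t \<le> (s * t) * t"
      using st t0 by (intro mult_right_mono) auto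
    then have "(\<tau> * \<beta>) * t < (\<tau> * \<beta>) * (K * \<beta>)"
      using lt by (simp add: power2_eq_square algebra_simps)
    then have tK: "t < \<beta> * K"
      using assms by (simp add: mult.commute)
    have "s * \<beta>\<^sup>2 \<le> s * t\<^sup>2"
      using s t assms by (intro mult_left_mono power_mono) auto
    then have "s * \<beta>\<^sup>2 < (\<tau> * K) * \<beta>\<^sup>2"
      using lt by (simp add: algebra_simps)
    then have sK: "s < \<tau> * K"
      by (rule mult_right_less_imp_less) simp
    have "\<tau> * \<beta> < s * (\<beta> * K)"
      using st tK s by (smt (verit) mult_strict_left_mono)
    then have sK': "\<tau> < s * K"
      using assms by (simp add: mult.left_commute)
    have p: "\<alpha> / s \<le> \<alpha> * K / \<tau>"
      using sK' s assms by (simp add: field_simps)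
    have q: "1 / K \<le> \<beta> / t" "\<beta> / t \<le> 1" "0 \<le> \<beta> / t"
      using tK t t0 K assms by (simp_all add: field_simps)
    have p0: "0 \<le> \<alpha> / s" using s assms by simp
    have "(\<alpha> / s) * (\<beta> / t) \<le> (\<alpha> / s) * 1"
      by (intro mult_left_mono q p0)
    then have pq: "(\<alpha> / s) * (\<beta> / t) \<le> \<alpha> * K / \<tau>"
      using p by simp
    have "?R K \<le> (1 - s\<^sup>2) * (1 - t\<^sup>2) * (1 - (\<alpha> / s) * (\<beta> / t))\<^sup>2"
    proof (intro mult_mono power_mono)
      have "s\<^sup>2 \<le> (\<tau> * K)\<^sup>2" "(\<tau> * K)\<^sup>2 \<le> 1" "t\<^sup>2 \<le> (\<beta> * K)\<^sup>2" "(\<beta> * K)\<^sup>2 \<le> 1"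
        using sK s tK t0 K assms by (auto intro!: power_mono power_le_one)
      then show "1 - (\<tau> * K)\<^sup>2 \<le> 1 - s\<^sup>2" "1 - (\<beta> * K)\<^sup>2 \<le> 1 - t\<^sup>2" "0 \<le> 1 - (\<beta> * K)\<^sup>2" "0 \<le> 1 - s\<^sup>2"
        "0 \<le> (1 - s\<^sup>2) * (1 - t\<^sup>2)"
        by auto
      show "1 - \<alpha> * K / \<tau> \<le> 1 - (\<alpha> / s) * (\<beta> / t)"
        using pq by simp
      show "0 \<le> 1 - \<alpha> * K / \<tau>"
        using K by simp
    qed auto
    also have "\<dots> \<le> 4 * ((1 - (\<alpha> / s)\<^sup>2) * (1 - (\<beta> / t)\<^sup>2))"
      by (rule le)
    also have "\<dots> \<le> 4 * (1 * (1 - (1 / K)\<^sup>2))"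
    proof (intro mult_left_mono mult_mono)
      have "(1 / K)\<^sup>2 \<le> (\<beta> / t)\<^sup>2"
        using q K by (intro power_mono) auto
      then show "1 - (\<beta> / t)\<^sup>2 \<le> 1 - (1 / K)\<^sup>2" by simp
      show "0 \<le> 1 - (\<beta> / t)\<^sup>2"
        using q power_le_one[of "\<beta> / t" 2] by simp
    qed auto
    finally show False
      using K(1) by simp
  qed
qed

section \<open>Upper bounds for the Green function of the bidisc\<close>

lemma open_bidisc: "open bidisc"
proof -
  have "open {z :: complex ^ 2. norm (z $ 1) < 1}" "open {z :: complex ^ 2. norm (z $ 2) < 1}"
    by (intro open_Collect_less continuous_intros)+
  moreover have "bidisc = {z. norm (z $ 1) < 1} \<inter> {z. norm (z $ 2) < 1}"
    by (auto simp: bidisc_def)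
  ultimately show ?thesis
    by (metis open_Int)
qed

lemma norm_diff_le_mob:
  assumes "norm w < 1" "norm z < 1"
  shows "norm (z - w) \<le> 2 * norm (mob w z)"
proof -
  have "norm (1 - cnj w * z) \<le> 1 + norm w * norm z"
    using norm_triangle_ineq4[of 1 "cnj w * z"] by (simp add: norm_mult)
  also have "\<dots> \<le> 1 + 1 * 1"
    using assms by (intro add_left_mono mult_mono) auto
  finally have "norm (mob w z) * norm (1 - cnj w * z) \<le> norm (mob w z) * 2"
    by (intro mult_left_mono) auto
  moreover have "mob w z * (1 - cnj w * z) = z - w"
    using one_minus_cnj_mult_nonzero[OF assms] by (simp add: Moebius_function_simple)
  then have "norm (mob w z) * norm (1 - cnj w * z) = norm (z - w)"
    by (metis norm_mult)
  ultimately show ?thesis by simp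
qed

text \<open>
  By the identity for the pseudohyperbolic distance, the denominator of the Moebius function being
  bounded below by \<open>1 - norm w\<close>.
\<close>

lemma mob_near_circle:
  assumes w: "norm w < 1" and \<eta>: "0 < \<eta>"
  shows "\<exists>s<1. \<forall>\<zeta>. s \<le> norm \<zeta> \<longrightarrow> norm \<zeta> < 1 \<longrightarrow> exp (- \<eta>) \<le> norm (mob w \<zeta>)"
proof -
  define c where "c = exp (- \<eta>)"
  have c: "0 < c" "c < 1"
    using \<eta> by (auto simp: c_def)
  have c2: "c\<^sup>2 < 1"
    using c by (simp add: power_less_one_iff abs_square_less_1)
  define k where "k = 1 - norm w"
  have k: "0 < k" "k \<le> 1"
    using w by (auto simp: k_def)
  \<comment> \<open>Chosen such that \<open>1 - s\<^sup>2\<close> is \<open>1 - c\<^sup>2\<close> times the square of the lower bound \<open>k\<close> for the denominator.\<close>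
  define s where "s = sqrt (1 - (1 - c\<^sup>2) * k\<^sup>2)"
  have "(1 - c\<^sup>2) * k\<^sup>2 \<le> 1 * 1"
    using c2 c k by (intro mult_mono) (auto simp: power_le_one)
  moreover have "(1 - c\<^sup>2) * k\<^sup>2 > 0"
    using c2 k by simp
  ultimately have s: "0 \<le> s" "s < 1" "s\<^sup>2 = 1 - (1 - c\<^sup>2) * k\<^sup>2"
    by (auto simp: s_def)
  show ?thesis
  proof (intro exI[of _ s] conjI s allI impI)
    fix \<zeta> :: complex assume \<zeta>: "s \<le> norm \<zeta>" "norm \<zeta> < 1"
    define d where "d = norm (1 - cnj w * \<zeta>)"
    have "k \<le> 1 - norm w * norm \<zeta>"
      using \<zeta> mult_left_le[of "norm \<zeta>" "norm w"] by (simp add: k_def)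
    also have "\<dots> \<le> d"
      using norm_triangle_ineq2[of 1 "cnj w * \<zeta>"] by (simp add: d_def norm_mult)
    finally have kd: "k \<le> d" .
    have "s\<^sup>2 \<le> (norm \<zeta>)\<^sup>2"
      using \<zeta> s by (intro power_mono)
    have w2: "1 - (norm w)\<^sup>2 \<le> 1" by simp
    have "d\<^sup>2 - (norm (\<zeta> - w))\<^sup>2 = (1 - (norm w)\<^sup>2) * (1 - (norm \<zeta>)\<^sup>2)"
      unfolding d_def by (rule pseudohyperbolic_identity)
    also have "\<dots> \<le> 1 * (1 - s\<^sup>2)"
      using \<open>s\<^sup>2 \<le> (norm \<zeta>)\<^sup>2\<close> \<zeta> w2 by (intro mult_mono) (auto simp: power_le_one)
    also have "\<dots> = (1 - c\<^sup>2) * k\<^sup>2"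
      by (simp add: s)
    also have "\<dots> \<le> (1 - c\<^sup>2) * d\<^sup>2"
      using c2 kd k by (intro mult_left_mono power_mono) auto
    finally have "(c * d)\<^sup>2 \<le> (norm (\<zeta> - w))\<^sup>2"
      by (simp add: power_mult_distrib algebra_simps)
    then have "c * d \<le> norm (\<zeta> - w)"
      by (rule power2_le_imp_le) simp
    then have "c \<le> norm (\<zeta> - w) / d"
      using k kd by (simp add: pos_le_divide_eq)
    then show "exp (- \<eta>) \<le> norm (mob w \<zeta>)"
      by (simp add: Moebius_function_simple norm_divide d_def c_def)
  qed
qed

text \<open>
  On the graph of \<open>P\<close> the distance to the pole is comparable with \<open>norm (mob w \<zeta>)\<close>, since the
  second coordinate does not exceed it.
\<close>

lemma psh_pole_along_graph:
  fixes w :: complex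
  assumes pole: "\<forall>\<^sub>F x in at (vector [w, 0] :: complex ^ 2).
      u x - ereal (\<nu> * ln (norm (x - vector [w, 0]))) \<le> ereal C"
    and w: "norm w < 1" and \<nu>: "0 \<le> \<nu>"
    and P: "\<And>\<zeta>. norm \<zeta> < 1 \<Longrightarrow> norm (P \<zeta>) \<le> norm (mob w \<zeta>)"
  obtains e C' where "0 < e"
    "\<And>\<zeta>. norm \<zeta> < 1 \<Longrightarrow> 0 < norm (mob w \<zeta>) \<Longrightarrow> norm (mob w \<zeta>) < e \<Longrightarrow>
      u (vector [\<zeta>, P \<zeta>]) \<le> ereal (\<nu> * ln (norm (mob w \<zeta>)) + C')"
proof -
  obtain d where d: "d > 0" "\<And>x. x \<noteq> vector [w, 0] \<Longrightarrow> dist x (vector [w, 0]) < d \<Longrightarrow>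
     u x - ereal (\<nu> * ln (norm (x - vector [w, 0]))) \<le> ereal C"
    using pole unfolding eventually_at by auto
  show ?thesis
  proof (rule that[of "d / 3" "\<nu> * ln 3 + C"])
    fix \<zeta> assume \<zeta>: "norm \<zeta> < 1" "0 < norm (mob w \<zeta>)" "norm (mob w \<zeta>) < d / 3"
    let ?x = "vector [\<zeta>, P \<zeta>] :: complex ^ 2"
    let ?D = "norm (?x - vector [w, 0])"
    have "\<zeta> \<noteq> w"
      using \<zeta>(2) by (auto simp: Moebius_function_eq_zero)
    then have ne: "?x \<noteq> vector [w, 0]"
      by (metis vector_2(1))
    have "?D \<le> norm (\<zeta> - w) + norm (P \<zeta>)"
      using L2_set_le_sum[of UNIV "\<lambda>i. norm ((?x - vector [w, 0]) $ i)"]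
      by (simp add: norm_vec_def UNIV_2)
    also have "\<dots> \<le> 3 * norm (mob w \<zeta>)"
      using norm_diff_le_mob[OF w \<zeta>(1)] P[OF \<zeta>(1)] by simp
    finally have D: "?D \<le> 3 * norm (mob w \<zeta>)" .
    have "u ?x - ereal (\<nu> * ln ?D) \<le> ereal C"
      by (rule d(2)[OF ne]) (use D \<zeta> in \<open>simp add: dist_norm\<close>)
    then have "u ?x \<le> ereal (C + \<nu> * ln ?D)"
      by (simp add: ereal_minus_le)
    also have "\<nu> * ln ?D \<le> \<nu> * ln (3 * norm (mob w \<zeta>))"
      using D ne \<nu> \<zeta>(2) by (intro mult_left_mono) (auto simp: ln_le_cancel_iff)
    then have "ereal (C + \<nu> * ln ?D) \<le> ereal (\<nu> * ln (norm (mob w \<zeta>)) + (\<nu> * ln 3 + C))"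
      using \<zeta>(2) by (simp add: ln_mult distrib_left)
    finally show "u ?x \<le> ereal (\<nu> * ln (norm (mob w \<zeta>)) + (\<nu> * ln 3 + C))" .
  qed (use d in simp)
qed

lemma psh_on_graph_le_ln:
  assumes u: "plurisubharmonic_on bidisc u" and neg: "\<And>x. x \<in> bidisc \<Longrightarrow> u x \<le> 0"
    and P: "P holomorphic_on ball 0 1" "\<And>\<zeta>. norm \<zeta> < 1 \<Longrightarrow> norm (P \<zeta>) < 1"
    and B: "B holomorphic_on ball 0 1"
    and bdry: "\<And>\<eta>. 0 < \<eta> \<Longrightarrow> \<exists>s<1. \<forall>\<zeta>. s \<le> norm \<zeta> \<longrightarrow> norm \<zeta> < 1 \<longrightarrow> exp (- \<eta>) \<le> norm (B \<zeta>)"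
    and pole: "0 < \<epsilon>" "\<And>\<zeta>. norm \<zeta> < 1 \<Longrightarrow> 0 < norm (B \<zeta>) \<Longrightarrow> norm (B \<zeta>) < \<epsilon> \<Longrightarrow>
        u (vector [\<zeta>, P \<zeta>]) \<le> ereal (ln (norm (B \<zeta>)) + C)"
    and p: "norm p < 1" "B p \<noteq> 0"
  shows "u (vector [p, P p]) \<le> ereal (ln (norm (B p)))"
proof (rule psh_le_ln_along_disc[OF u open_bidisc neg, where f = "\<lambda>\<zeta>. vector [\<zeta>, P \<zeta>]"])
  have "\<forall>i::2. (\<lambda>\<xi>. (vector [\<xi>, P \<xi>] :: complex ^ 2) $ i) holomorphic_on ball 0 1"
    unfolding forall_2 using P(1) by (simp add: holomorphic_intros)
  then show "(\<lambda>\<xi>. (vector [\<xi>, P \<xi>] :: complex ^ 2) $ i) holomorphic_on ball 0 1" for i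
    by blast
  show "(\<lambda>\<zeta>. vector [\<zeta>, P \<zeta>]) ` ball 0 1 \<subseteq> bidisc"
    using P(2) by (auto simp: bidisc_def)
qed (use assms in auto)

text \<open>
  The disc is the graph of \<open>c * mob b\<close>, which passes through the pole of weight \<open>2\<close> and, over
  \<open>\<zeta> = 0\<close>, through the given point; the comparison function is the square of \<open>mob b\<close>.
\<close>

lemma psh_bound_double_pole:
  assumes u: "plurisubharmonic_on bidisc u" and neg: "\<And>x. x \<in> bidisc \<Longrightarrow> u x \<le> 0"
    and pole: "\<forall>\<^sub>F x in at (vector [b, 0]). u x - ereal (2 * ln (norm (x - vector [b, 0]))) \<le> ereal C"
    and b: "0 < norm b" "norm b < 1" and y: "norm y = norm b"
  shows "u (vector [0, y]) \<le> ereal (2 * ln (norm b))"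
proof -
  define c where "c = - y / b"
  have c: "norm c = 1"
    using b y by (simp add: c_def norm_divide)
  define P where "P \<zeta> = c * mob b \<zeta>" for \<zeta>
  have nP: "norm (P \<zeta>) = norm (mob b \<zeta>)" for \<zeta>
    by (simp add: P_def norm_mult c)
  have hm: "mob b holomorphic_on ball 0 1"
    by (rule Moebius_function_holomorphic[OF b(2)])
  obtain e C' where e: "0 < e"
    "\<And>\<zeta>. norm \<zeta> < 1 \<Longrightarrow> 0 < norm (mob b \<zeta>) \<Longrightarrow> norm (mob b \<zeta>) < e \<Longrightarrow>
      u (vector [\<zeta>, P \<zeta>]) \<le> ereal (2 * ln (norm (mob b \<zeta>)) + C')"
    using psh_pole_along_graph[OF pole b(2), of P] nP by (metis order_refl zero_le_numeral)
  have "u (vector [0, P 0]) \<le> ereal (ln (norm ((mob b 0)\<^sup>2)))"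
  proof (rule psh_on_graph_le_ln[OF u neg, where \<epsilon> = "e\<^sup>2" and C = C'])
    show "P holomorphic_on ball 0 1" "(\<lambda>\<zeta>. (mob b \<zeta>)\<^sup>2) holomorphic_on ball 0 1"
      unfolding P_def by (intro holomorphic_intros hm)+
    show "norm (P \<zeta>) < 1" if "norm \<zeta> < 1" for \<zeta>
      unfolding nP by (rule Moebius_function_norm_lt_1[OF b(2) that])
    show "\<exists>s<1. \<forall>\<zeta>. s \<le> norm \<zeta> \<longrightarrow> norm \<zeta> < 1 \<longrightarrow> exp (- \<eta>) \<le> norm ((mob b \<zeta>)\<^sup>2)" if \<eta>: "0 < \<eta>" for \<eta>
    proof -
      obtain s where s: "s < 1" "\<And>\<zeta>. s \<le> norm \<zeta> \<Longrightarrow> norm \<zeta> < 1 \<Longrightarrow> exp (- (\<eta> / 2)) \<le> norm (mob b \<zeta>)"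
        using mob_near_circle[OF b(2), of "\<eta> / 2"] \<eta> by (metis half_gt_zero)
      have "exp (- \<eta>) \<le> norm ((mob b \<zeta>)\<^sup>2)" if "s \<le> norm \<zeta>" "norm \<zeta> < 1" for \<zeta>
      proof -
        have "exp (- \<eta>) = (exp (- (\<eta> / 2)))\<^sup>2"
          by (simp flip: exp_double)
        also have "\<dots> \<le> (norm (mob b \<zeta>))\<^sup>2"
          by (intro power_mono s that) auto
        finally show ?thesis
          by (simp add: norm_power)
      qed
      with s(1) show ?thesis by blast
    qed
    show "u (vector [\<zeta>, P \<zeta>]) \<le> ereal (ln (norm ((mob b \<zeta>)\<^sup>2)) + C')"
      if "norm \<zeta> < 1" "0 < norm ((mob b \<zeta>)\<^sup>2)" "norm ((mob b \<zeta>)\<^sup>2) < e\<^sup>2" for \<zeta>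
    proof -
      have "0 < norm (mob b \<zeta>)"
        using that(2) by (simp add: norm_power)
      moreover have "norm (mob b \<zeta>) < e"
        using that(3) e(1) by (simp add: norm_power power2_less_imp_less)
      ultimately show ?thesis
        using e(2)[OF that(1)] by (simp add: norm_power ln_realpow)
    qed
  qed (use e b in \<open>auto simp: Moebius_function_of_zero\<close>)
  moreover have "P 0 = y"
    using b by (auto simp: P_def c_def Moebius_function_of_zero)
  ultimately show ?thesis
    using b by (simp add: Moebius_function_of_zero norm_power ln_realpow)
qed

text \<open>
  The disc is the graph of \<open>c * (mob a * mob b)\<close>, which passes through both poles and the given
  point; the comparison function \<open>mob a * (mob b)\<^sup>2\<close> has the weights as multiplicities.
\<close>

lemma psh_bound_both_poles:
  assumes u: "plurisubharmonic_on bidisc u" and neg: "\<And>x. x \<in> bidisc \<Longrightarrow> u x \<le> 0"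
    and pole_a: "\<forall>\<^sub>F x in at (vector [a, 0]). u x - ereal (1 * ln (norm (x - vector [a, 0]))) \<le> ereal Ca"
    and pole_b: "\<forall>\<^sub>F x in at (vector [b, 0]). u x - ereal (2 * ln (norm (x - vector [b, 0]))) \<le> ereal Cb"
    and a: "0 < norm a" "norm a < 1" and b: "0 < norm b" "norm b < 1" and "a \<noteq> b"
    and y: "norm y = norm a * norm b"
  shows "u (vector [0, y]) \<le> ereal (ln (norm a) + 2 * ln (norm b))"
proof -
  define c where "c = y / (a * b)"
  have c: "norm c = 1"
    using a b y by (simp add: c_def norm_divide norm_mult)
  define P where "P \<zeta> = c * (mob a \<zeta> * mob b \<zeta>)" for \<zeta>
  define B where "B \<zeta> = mob a \<zeta> * (mob b \<zeta>)\<^sup>2" for \<zeta>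
  have nB: "norm (B \<zeta>) = norm (mob a \<zeta>) * (norm (mob b \<zeta>))\<^sup>2" for \<zeta>
    by (simp add: B_def norm_mult norm_power)
  have nP: "norm (P \<zeta>) = norm (mob a \<zeta>) * norm (mob b \<zeta>)" for \<zeta>
    by (simp add: P_def norm_mult c)
  have lt1: "norm (mob a \<zeta>) < 1" "norm (mob b \<zeta>) < 1" if "norm \<zeta> < 1" for \<zeta>
    using Moebius_function_norm_lt_1 a b that by auto
  have Pa: "norm (P \<zeta>) \<le> norm (mob a \<zeta>)" and Pb: "norm (P \<zeta>) \<le> norm (mob b \<zeta>)" if "norm \<zeta> < 1" for \<zeta>
    unfolding nP using lt1[OF that] by (auto intro: mult_left_le mult_left_le_one_le)
  have hm: "mob a holomorphic_on ball 0 1" "mob b holomorphic_on ball 0 1"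
    using Moebius_function_holomorphic a b by auto
  obtain e1 C1 where e1: "0 < e1"
    "\<And>\<zeta>. norm \<zeta> < 1 \<Longrightarrow> 0 < norm (mob a \<zeta>) \<Longrightarrow> norm (mob a \<zeta>) < e1 \<Longrightarrow>
      u (vector [\<zeta>, P \<zeta>]) \<le> ereal (1 * ln (norm (mob a \<zeta>)) + C1)"
    using psh_pole_along_graph[OF pole_a a(2) _ Pa] by (metis zero_le_one)
  obtain e2 C2 where e2: "0 < e2"
    "\<And>\<zeta>. norm \<zeta> < 1 \<Longrightarrow> 0 < norm (mob b \<zeta>) \<Longrightarrow> norm (mob b \<zeta>) < e2 \<Longrightarrow>
      u (vector [\<zeta>, P \<zeta>]) \<le> ereal (2 * ln (norm (mob b \<zeta>)) + C2)"
    using psh_pole_along_graph[OF pole_b b(2) _ Pb] by (metis zero_le_numeral)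
  \<comment> \<open>The two Moebius functions cannot both be smaller than this, the zeros being apart.\<close>
  define e3 where "e3 = norm (a - b) / 4"
  have e3: "0 < e3"
    using \<open>a \<noteq> b\<close> by (simp add: e3_def)
  have far: "e3 \<le> norm (mob b \<zeta>)" if "norm \<zeta> < 1" "norm (mob a \<zeta>) < e3" for \<zeta>
    using norm_diff_le_mob[OF a(2) that(1)] norm_diff_le_mob[OF b(2) that(1)] that(2)
      norm_triangle_ineq[of "a - \<zeta>" "\<zeta> - b"] by (simp add: e3_def norm_minus_commute)
  have far': "e3 \<le> norm (mob a \<zeta>)" if "norm \<zeta> < 1" "norm (mob b \<zeta>) < e3" for \<zeta>
    using far that by force
  define e where "e = Min {e1, e2, e3}"
  have e: "0 < e" "e \<le> e1" "e \<le> e2" "e \<le> e3"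
    using e1 e2 e3 by (auto simp: e_def)
  define C where "C = max (C1 - 2 * ln e3) (C2 - ln e3)"
  have "u (vector [0, P 0]) \<le> ereal (ln (norm (B 0)))"
  proof (rule psh_on_graph_le_ln[OF u neg, where \<epsilon> = "e ^ 3" and C = C])
    show "P holomorphic_on ball 0 1" "B holomorphic_on ball 0 1"
      unfolding P_def B_def by (intro holomorphic_intros hm)+
    show "norm (P \<zeta>) < 1" if "norm \<zeta> < 1" for \<zeta>
      using Pa[OF that] lt1[OF that] by simp
    show "\<exists>s<1. \<forall>\<zeta>. s \<le> norm \<zeta> \<longrightarrow> norm \<zeta> < 1 \<longrightarrow> exp (- \<eta>) \<le> norm (B \<zeta>)" if \<eta>: "0 < \<eta>" for \<eta>
    proof -
      have \<eta>3: "0 < \<eta> / 3"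
        using \<eta> by simp
      obtain s where s: "s < 1" "\<And>\<zeta>. s \<le> norm \<zeta> \<Longrightarrow> norm \<zeta> < 1 \<Longrightarrow> exp (- (\<eta> / 3)) \<le> norm (mob a \<zeta>)"
        using mob_near_circle[OF a(2) \<eta>3] by metis
      obtain s' where s': "s' < 1" "\<And>\<zeta>. s' \<le> norm \<zeta> \<Longrightarrow> norm \<zeta> < 1 \<Longrightarrow> exp (- (\<eta> / 3)) \<le> norm (mob b \<zeta>)"
        using mob_near_circle[OF b(2) \<eta>3] by metis
      have "exp (- \<eta>) \<le> norm (B \<zeta>)" if "max s s' \<le> norm \<zeta>" "norm \<zeta> < 1" for \<zeta>
      proof -
        have "exp (- \<eta>) = exp (- (\<eta> / 3)) * (exp (- (\<eta> / 3)))\<^sup>2"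
          by (simp flip: exp_double exp_add)
        also have "\<dots> \<le> norm (mob a \<zeta>) * (norm (mob b \<zeta>))\<^sup>2"
          by (intro mult_mono power_mono s s') (use that in auto)
        finally show ?thesis
          by (simp add: nB)
      qed
      with s(1) s'(1) show ?thesis
        by (intro exI[of _ "max s s'"]) auto
    qed
    show "u (vector [\<zeta>, P \<zeta>]) \<le> ereal (ln (norm (B \<zeta>)) + C)"
      if \<zeta>: "norm \<zeta> < 1" "0 < norm (B \<zeta>)" "norm (B \<zeta>) < e ^ 3" for \<zeta>
    proof -
      let ?A = "norm (mob a \<zeta>)" and ?B = "norm (mob b \<zeta>)"
      have pos: "0 < ?A" "0 < ?B"
        using \<zeta>(2) by (auto simp: B_def)
      have lnB: "ln (norm (B \<zeta>)) = ln ?A + 2 * ln ?B"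
        unfolding nB using pos by (simp add: ln_mult ln_realpow)
      have "?A < e \<or> ?B < e"
      proof (rule ccontr)
        assume "\<not> (?A < e \<or> ?B < e)"
        then have "e * e\<^sup>2 \<le> ?A * ?B\<^sup>2"
          using e(1) by (intro mult_mono power_mono) auto
        with \<zeta>(3) show False
          by (simp add: nB power3_eq_cube power2_eq_square)
      qed
      then show ?thesis
      proof
        assume A: "?A < e"
        have "u (vector [\<zeta>, P \<zeta>]) \<le> ereal (ln ?A + C1)"
          using e1(2)[OF \<zeta>(1) pos(1)] A e by simp
        also have "ln e3 \<le> ln ?B"
          by (rule iffD2[OF ln_le_cancel_iff[OF e3 pos(2)] far[OF \<zeta>(1) less_le_trans[OF A e(4)]]])
        then have "ereal (ln ?A + C1) \<le> ereal (ln (norm (B \<zeta>)) + C)"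
          unfolding lnB C_def by simp
        finally show ?thesis .
      next
        assume A: "?B < e"
        have "u (vector [\<zeta>, P \<zeta>]) \<le> ereal (2 * ln ?B + C2)"
          using e2(2)[OF \<zeta>(1) pos(2)] A e by simp
        also have "ln e3 \<le> ln ?A"
          by (rule iffD2[OF ln_le_cancel_iff[OF e3 pos(1)] far'[OF \<zeta>(1) less_le_trans[OF A e(4)]]])
        then have "ereal (2 * ln ?B + C2) \<le> ereal (ln (norm (B \<zeta>)) + C)"
          unfolding lnB C_def by simp
        finally show ?thesis .
      qed
    qed
  qed (use e a b in \<open>auto simp: Moebius_function_of_zero B_def\<close>)
  moreover have "P 0 = y"
    using a b by (auto simp: P_def c_def Moebius_function_of_zero)
  ultimately show ?thesis
    using a b by (simp add: nB Moebius_function_of_zero ln_mult ln_realpow)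
qed

text \<open>
  On the line \<open>z\<^sub>1 = 0\<close> the right-hand side is harmonic in the annulus, and on its two boundary
  circles it coincides with the bounds coming from one and from both poles.
\<close>

lemma psh_bound_annulus:
  assumes u: "plurisubharmonic_on bidisc u" and neg: "\<And>x. x \<in> bidisc \<Longrightarrow> u x \<le> 0"
    and pole_a: "\<forall>\<^sub>F x in at (vector [a, 0]). u x - ereal (1 * ln (norm (x - vector [a, 0]))) \<le> ereal Ca"
    and pole_b: "\<forall>\<^sub>F x in at (vector [b, 0]). u x - ereal (2 * ln (norm (x - vector [b, 0]))) \<le> ereal Cb"
    and a: "0 < norm a" "norm a < 1" and b: "0 < norm b" "norm b < 1" and "a \<noteq> b"
    and y: "norm a * norm b \<le> norm y" "norm y \<le> norm b"
  shows "u (vector [0, y]) \<le> ereal (ln (norm y) + ln (norm b))"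
proof -
  define K where "K = cball (0::complex) (norm b) - ball 0 (norm a * norm b)"
  have K: "compact K" "K \<subseteq> ball 0 1"
    unfolding K_def using b by (auto intro: compact_diff)
  have K0: "\<zeta> \<noteq> 0" if "\<zeta> \<in> K" for \<zeta>
    using that a b by (auto simp: K_def)
  have "u (vector [0, y]) \<le> ereal (1 * ln (norm y) + ln (norm b))"
  proof (rule psh_maximum_principle_along_disc[OF u open_bidisc open_ball neg K,
        where f = "\<lambda>\<zeta>. vector [0, \<zeta>]" and H = "\<lambda>\<zeta>. 1 * ln (norm \<zeta>) + ln (norm b)"])
    have "\<forall>i::2. (\<lambda>\<xi>. (vector [0, \<xi>] :: complex ^ 2) $ i) holomorphic_on ball 0 1"
      unfolding forall_2 by (simp add: holomorphic_intros)
    then show "(\<lambda>\<xi>. (vector [0, \<xi>] :: complex ^ 2) $ i) holomorphic_on ball 0 1" for i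
      by blast
    show "(\<lambda>\<zeta>. vector [0, \<zeta>]) ` ball 0 1 \<subseteq> bidisc"
      by (auto simp: bidisc_def)
    show "continuous_on K (\<lambda>\<zeta>. 1 * ln (norm \<zeta>) + ln (norm b))"
      using K0 by (intro continuous_intros) auto
    show "\<exists>e>0. \<exists>L. L holomorphic_on ball q e \<and> (\<forall>\<zeta>\<in>ball q e. 1 * ln (norm \<zeta>) + ln (norm b) = Re (L \<zeta>))"
      if "q \<in> interior K" for q
      using ln_norm_holomorphic_locally_harmonic[of "\<lambda>\<zeta>. \<zeta>" UNIV q 1 "ln (norm b)"] K0[OF subsetD[OF interior_subset that]]
      by (auto intro: holomorphic_intros)
    show "y \<in> K"
      using y by (simp add: K_def)
    fix \<zeta> assume \<zeta>: "\<zeta> \<in> frontier K"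
    then have "\<zeta> \<in> K"
      using K(1) compact_imp_closed frontier_subset_closed by blast
    have "norm \<zeta> = norm b \<or> norm \<zeta> = norm a * norm b"
    proof (rule ccontr)
      assume *: "\<not> (norm \<zeta> = norm b \<or> norm \<zeta> = norm a * norm b)"
      have "open (ball (0::complex) (norm b) - cball 0 (norm a * norm b))"
        by (intro open_Diff) auto
      moreover have "\<zeta> \<in> ball 0 (norm b) - cball 0 (norm a * norm b)"
        "ball (0::complex) (norm b) - cball 0 (norm a * norm b) \<subseteq> K"
        using \<open>\<zeta> \<in> K\<close> * by (auto simp: K_def)
      ultimately have "\<zeta> \<in> interior K"
        by (meson interiorI)
      with \<zeta> show False
        by (simp add: frontier_def)
    qed
    then show "u (vector [0, \<zeta>]) \<le> ereal (1 * ln (norm \<zeta>) + ln (norm b))"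
    proof
      assume "norm \<zeta> = norm b"
      then show ?thesis
        using psh_bound_double_pole[OF u neg pole_b b, of \<zeta>] by simp
    next
      assume n: "norm \<zeta> = norm a * norm b"
      have "ln (norm \<zeta>) = ln (norm a) + ln (norm b)"
        unfolding n using a b by (simp add: ln_mult)
      then show ?thesis
        using psh_bound_both_poles[OF u neg pole_a pole_b a b \<open>a \<noteq> b\<close> n] by (simp add: algebra_simps)
    qed
  qed
  then show ?thesis by simp
qed

proposition pluricomplex_green_le:
  assumes a: "0 < norm a" "norm a < 1" and b: "0 < norm b" "norm b < 1" and "a \<noteq> b"
    and y: "norm a * norm b \<le> norm y" "norm y \<le> norm b"
  shows "pluricomplex_green bidisc {(vector [a, 0], 1), (vector [b, 0], 2)} (vector [0, y])
    \<le> ereal (ln (norm y) + ln (norm b))"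
  unfolding pluricomplex_green_def
proof (rule Sup_least, clarify)
  fix u
  assume u: "plurisubharmonic_on bidisc u" and neg: "\<forall>\<zeta>\<in>bidisc. u \<zeta> \<le> 0"
    and "\<forall>(w, \<nu>)\<in>{(vector [a, 0], 1), (vector [b, 0], 2)}.
      \<exists>C. \<forall>\<^sub>F \<zeta> in at w. u \<zeta> - ereal (\<nu> * ln (norm (\<zeta> - w))) \<le> ereal C"
  then obtain Ca Cb where
    "\<forall>\<^sub>F x in at (vector [a, 0]). u x - ereal (1 * ln (norm (x - vector [a, 0]))) \<le> ereal Ca"
    "\<forall>\<^sub>F x in at (vector [b, 0]). u x - ereal (2 * ln (norm (x - vector [b, 0]))) \<le> ereal Cb"
    by auto
  from psh_bound_annulus[OF u _ this assms] neg
  show "u (vector [0, y]) \<le> ereal (ln (norm y) + ln (norm b))"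
    by blast
qed

section \<open>The gap between the two functions\<close>

text \<open>
  Let \<open>s\<close> and \<open>t\<close> be the parameters of the poles on a disc \<open>f\<close>. The second coordinate vanishes at
  both, hence \<open>norm y \<le> norm s * norm t\<close>; the first one gives \<open>norm b \<le> norm t\<close>. Thus
  \<open>norm y * norm b\<close> bounds \<open>norm s * (norm t)\<^sup>2\<close> from below. Equality would make the first
  coordinate a rotation and force \<open>norm s = norm a\<close>, although then
  \<open>norm s = norm y / norm b > norm a\<close>; the factor \<open>K\<close> makes this uniform in \<open>f\<close>.
\<close>

proposition lempert_function_ge:
  assumes a: "0 < norm a" "norm a < 1" and b: "0 < norm b" "norm b < 1" and "a \<noteq> b"
    and y: "norm a * norm b < norm y" "norm y < norm b"
  obtains K where "1 < K"
    "ereal (ln (K * (norm y * norm b)))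
      \<le> lempert_function bidisc {(vector [a, 0], 1), (vector [b, 0], 2)} (vector [0, y])"
proof -
  let ?va = "vector [a, 0] :: complex ^ 2" and ?vb = "vector [b, 0] :: complex ^ 2"
  define \<tau> where "\<tau> = norm y / norm b"
  have \<tau>: "norm a < \<tau>" "\<tau> < 1" "\<tau> * norm b = norm y" "\<tau> * (norm b)\<^sup>2 = norm y * norm b"
    using b y by (auto simp: \<tau>_def field_simps power2_eq_square)
  obtain K where K: "1 < K"
    "\<And>s t. 0 < s \<Longrightarrow> norm b \<le> t \<Longrightarrow> \<tau> * norm b \<le> s * t \<Longrightarrow>
       (1 - s\<^sup>2) * (1 - t\<^sup>2) * (1 - (norm a / s) * (norm b / t))\<^sup>2
         \<le> 4 * ((1 - (norm a / s)\<^sup>2) * (1 - (norm b / t)\<^sup>2)) \<Longrightarrow>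
       K * (\<tau> * (norm b)\<^sup>2) \<le> s * t\<^sup>2"
    using parameter_gap[OF a(1) \<tau>(1,2) b] by blast
  have ne: "?va \<noteq> ?vb"
    using \<open>a \<noteq> b\<close> by (metis vector_2(1))
  have "ereal (ln (K * (norm y * norm b))) \<le> (\<Sum>(w, \<nu>)\<in>{(?va, 1), (?vb, 2)}. ereal \<nu> * log_ereal (norm (\<zeta> w)))"
    if hol: "\<forall>i. (\<lambda>\<xi>. f \<xi> $ i) holomorphic_on ball 0 1" and im: "f ` ball 0 1 \<subseteq> bidisc"
      and f0: "f 0 = vector [0, y]"
      and \<zeta>: "\<forall>(w, \<nu>)\<in>{(?va, 1::real), (?vb, 2)}. \<zeta> w \<in> ball 0 1 \<and> f (\<zeta> w) = w"
    for f :: "complex \<Rightarrow> complex ^ 2" and \<zeta> :: "complex ^ 2 \<Rightarrow> complex"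
  proof -
    define s t where "s = \<zeta> ?va" and "t = \<zeta> ?vb"
    have s: "norm s < 1" "f s = ?va" and t: "norm t < 1" "f t = ?vb"
      using \<zeta> by (auto simp: s_def t_def)
    have nz: "s \<noteq> 0" "t \<noteq> 0" "s \<noteq> t"
      using s t f0 ne a b by (auto simp: vector_2 dest!: arg_cong[where f = "\<lambda>v :: complex ^ 2. v $ 1"])
    have le: "norm (f z $ 1) \<le> 1" "norm (f z $ 2) \<le> 1" if "norm z < 1" for z
      using im that by (auto simp: bidisc_def image_subset_iff less_imp_le)
    note SP = three_point_Schwarz_Pick[of "\<lambda>z. f z $ 1" s t, OF _ le(1) _ s(1) nz(1) t(1) nz(2)]
    have "norm b / norm t \<le> 1"
      using SP(3) hol f0 t by simp
    then have bt: "norm b \<le> norm t"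
      using nz by (simp add: field_simps)
    have yst: "norm y \<le> norm s * norm t"
      using norm_at_0_le_prod_zeros[of "\<lambda>z. f z $ 2" s t, OF _ le(2) s(1) t(1)] hol f0 s t nz by simp
    have "K * (\<tau> * (norm b)\<^sup>2) \<le> norm s * (norm t)\<^sup>2"
      by (rule K(2)) (use nz bt yst \<tau>(3) SP(1) hol f0 s t in auto)
    moreover have "0 < norm y"
      by (rule less_trans[OF mult_pos_pos[OF a(1) b(1)] y(1)])
    then have "0 < K * (norm y * norm b)"
      using K(1) b by (intro mult_pos_pos) auto
    ultimately have "ln (K * (norm y * norm b)) \<le> ln (norm s * (norm t)\<^sup>2)"
      unfolding \<tau>(4) using nz by (subst ln_le_cancel_iff) auto
    also have "\<dots> = ln (norm s) + 2 * ln (norm t)"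
      using nz by (simp add: ln_mult ln_realpow)
    finally show ?thesis
      using nz ne by (simp add: log_ereal_def flip: s_def t_def)
  qed
  then have "ereal (ln (K * (norm y * norm b))) \<le> lempert_function bidisc {(?va, 1), (?vb, 2)} (vector [0, y])"
    unfolding lempert_function_def by (intro Inf_greatest) blast
  with K(1) show ?thesis
    by (rule that)
qed

theorem mainTheorem1:
  fixes a b :: complex
  assumes "0 < norm a" "norm a < 1"
    and "0 < norm b" "norm b < 1"
    and "a \<noteq> b"
  shows "\<exists>z\<in>bidisc.
    lempert_function bidisc {(vector [a, 0], 1), (vector [b, 0], 2)} z
      \<noteq> pluricomplex_green bidisc {(vector [a, 0], 1), (vector [b, 0], 2)} z"
proof -
  have "norm a * norm b < norm b"
    using assms by simp
  then obtain r where r: "norm a * norm b < r" "r < norm b"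
    using dense by blast
  have "0 < r"
    using r(1) assms by (smt (verit) mult_pos_pos)
  then have y: "norm (complex_of_real r) = r"
    by simp
  let ?A = "{(vector [a, 0] :: complex ^ 2, 1::real), (vector [b, 0], 2)}" and ?z = "vector [0, complex_of_real r] :: complex ^ 2"
  obtain K where K: "1 < K" "ereal (ln (K * (r * norm b))) \<le> lempert_function bidisc ?A ?z"
    using lempert_function_ge[OF assms, of "complex_of_real r"] r y by metis
  have "pluricomplex_green bidisc ?A ?z \<le> ereal (ln r + ln (norm b))"
    using pluricomplex_green_le[OF assms, of "complex_of_real r"] r y by simp
  also have "\<dots> < ereal (ln (K * (r * norm b)))"
    using K(1) \<open>0 < r\<close> assms by (simp add: ln_mult)
  also have "\<dots> \<le> lempert_function bidisc ?A ?z"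
    by (rule K(2))
  finally have "lempert_function bidisc ?A ?z \<noteq> pluricomplex_green bidisc ?A ?z"
    by simp
  moreover have "?z \<in> bidisc"
    using y r assms by (simp add: bidisc_def)
  ultimately show ?thesis
    by blast
qed

end
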